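(* Let $d\ge2$ and let $\mu$ be a centered probability measure on $\mathbb{R}^d$ such that $X\sim\mu$ satisfies $\|X\|_{\psi_2}<+\infty$. Let $\lambda_1\ge\lambda_2\ge\dots\ge\lambda_d$ be the eigenvalues of $\mathrm{Cov}(\mu)=\mathbb{E}[XX^T]$ and assume $\lambda_1>\lambda_2$. Let $X_1,\dots,X_n$ be independent with law $\mu$, let $\mathcal S=\arg\max_{\phi\in\mathbb{S}^{d-1}}\langle\mathrm{Cov}(\mu)\phi,\phi\rangle$ and $\widehat{\mathcal S}=\arg\max_{\phi\in\mathbb{S}^{d-1}}\langle\frac1n\sum_{i=1}^nX_iX_i^T\phi,\phi\rangle$. Set $$c=\frac{(\lambda_1-\lambda_2)^2}{32e^2(d+1)^2\|X\|_{\psi_2}^4+8e(d+1)\|X\|_{\psi_2}^2(\lambda_1-\lambda_2)},$$ $$L=\frac{2d\pi^2\|X\|_{\psi_2}^2}{\lambda_1-\lambda_2},\qquad C_1=14L+2\sqrt{L\pi},\qquad C_2=4(L\pi+8L^2)+\pi^2.$$ Then, for any $\delta>0$, $$\vartheta(\widehat{\mathcal S};\mathcal S)\le8L\left(n^{-\frac12}+2\sqrt{\frac1n\log\left(\frac1\delta\right)}+\frac1n\log\left(\frac1\delta\right)\right)+C_1d^{\frac14}e^{-\frac c4n}$$ with probability at least $1-2d\,e^{-cn}-\delta$, and $$\mathbb{E}\left[\vartheta(\widehat{\mathcal S};\mathcal S)^2\right]\le2^6L^2n^{-1}+C_2d^{\frac12}e^{-\frac c2n}.$$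
   Context: $\mathbb{S}^{d-1}$ is the unit sphere of $\mathbb{R}^d$ with the great circle distance $\vartheta(\phi,\psi)=\arccos\langle\phi,\psi\rangle$. For subsets $E,E'$ of the sphere, $\vartheta(E;E')=\sup_{\phi\in E}\inf_{\psi\in E'}\vartheta(\phi,\psi)$. For a real random variable $Z$, $\|Z\|_{\psi_2}=\inf\{c>0:\mathbb{E}\exp(|Z|^2/c^2)\le2\}$; for a random vector $X\in\mathbb{R}^d$, $\|X\|_{\psi_2}=\sup_{v\in\mathbb{S}^{d-1}}\|\langle X,v\rangle\|_{\psi_2}$. For $\delta\ge1$ the probability statement is vacuous. *)

theory Defs
  imports "HOL-Probability.Probability"
begin

(* The exponential moment is a nonnegative integral, since it may be infinite;
   if no c is admissible, the infimum over the empty set is \<infinity>. *)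
definition psi2_norm :: "'a measure \<Rightarrow> ('a \<Rightarrow> real) \<Rightarrow> ennreal" where
  "psi2_norm M Z =
     (INF c \<in> {c::real. 0 < c \<and> (\<integral>\<^sup>+ \<omega>. ennreal (exp (\<bar>Z \<omega>\<bar>\<^sup>2 / c\<^sup>2)) \<partial>M) \<le> 2}. ennreal c)"

definition psi2_norm_vec :: "'a measure \<Rightarrow> ('a \<Rightarrow> real^'n) \<Rightarrow> ennreal" where
  "psi2_norm_vec M X = (SUP v \<in> sphere 0 1. psi2_norm M (\<lambda>\<omega>. X \<omega> \<bullet> v))"

definition outer :: "real^'n \<Rightarrow> real^'n^'n" where
  "outer x = (\<chi> i j. x $ i * x $ j)"

(* E[X X^T] for X with law \<mu>; this is the covariance matrix only when \<mu> is centered. *)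
definition cov_matrix :: "(real^'n) measure \<Rightarrow> real^'n^'n" where
  "cov_matrix \<mu> = (\<integral>x. outer x \<partial>\<mu>)"

definition empirical_cov :: "nat \<Rightarrow> (nat \<Rightarrow> 'a \<Rightarrow> real^'n) \<Rightarrow> 'a \<Rightarrow> real^'n^'n" where
  "empirical_cov n X \<omega> = (1 / real n) *\<^sub>R (\<Sum>i\<in>{1..n}. outer (X i \<omega>))"

(* lam 1 \<ge> ... \<ge> lam d are the eigenvalues of A, each repeated as often as the
   dimension of its eigenspace. Intended for symmetric A, where these dimensions
   are the multiplicities and add up to d. Values outside {1..d} are irrelevant. *)
definition eigenvalues_desc :: "real^'n^'n \<Rightarrow> (nat \<Rightarrow> real) \<Rightarrow> bool" where
  "eigenvalues_desc A lam \<longleftrightarrow>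
     antimono_on {1..CARD('n)} lam \<and>
     (\<forall>t. card {i \<in> {1..CARD('n)}. lam i = t} = dim {v. A *v v = t *\<^sub>R v})"

definition max_directions :: "real^'n^'n \<Rightarrow> (real^'n) set" where
  "max_directions A =
     {\<phi>. is_arg_max (\<lambda>\<phi>. (A *v \<phi>) \<bullet> \<phi>) (\<lambda>\<phi>. \<phi> \<in> sphere 0 1) \<phi>}"

definition gc_dist :: "real^'n \<Rightarrow> real^'n \<Rightarrow> real" where
  "gc_dist \<phi> \<psi> = arccos (\<phi> \<bullet> \<psi>)"

(* Supremum and infimum are real-valued, hence meaningful for nonempty subsets
   of the unit sphere, on which gc_dist takes values in [0, pi]. *)
definition gc_dev :: "(real^'n) set \<Rightarrow> (real^'n) set \<Rightarrow> real" where
  "gc_dev E E' = (SUP \<phi>\<in>E. INF \<psi>\<in>E'. gc_dist \<phi> \<psi>)"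

end

theory Submission
  imports Defs
begin

text \<open>
  Write \<open>A\<close> for the covariance, \<open>B\<close> for its empirical version, \<open>g\<close> for the spectral gap and \<open>d\<close>
  for the dimension. If \<open>\<phi>\<close> maximises the form of \<open>B\<close>, \<open>u\<close> that of \<open>A\<close>, and \<open>\<theta>\<close> is the angle
  between the lines they span, then comparing the two forms at \<open>\<phi>\<close> and \<open>u\<close> gives
  \<open>g sin\<^sup>2 \<theta> \<le> \<langle>(B - A)(\<phi> - u), \<phi> + u\<rangle> \<le> 2 sin \<theta> \<parallel>B - A\<parallel>\<close> in Frobenius norm, so that the deviation is at
  most \<open>(4 / g) \<parallel>B - A\<parallel>\<close>, without any smallness condition on \<open>B - A\<close>.
  Each entry of \<open>B - A\<close> is a centred average of subexponential variables. Since \<open>y \<mapsto> cosh (sqrt y)\<close>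
  is convex, \<open>cosh (t \<parallel>B - A\<parallel> / d)\<close> is at most the mean of \<open>cosh\<close> of \<open>t\<close> times the entries, which transfers
  the exponential moment bound from entries to the norm with no logarithmic loss in \<open>d\<close>. Both
  estimates follow, and the exponentially small terms of the statement are only extra room.
\<close>

subsection \<open>Elementary inequalities\<close>

text \<open>The remainder series starts at order two, so shrinking the argument by
  \<open>r \<le> 1\<close> gains at least \<open>r\<^sup>2\<close> in every term. This factor later
  makes the exponent of the moment bound quadratic in the parameter.\<close>

lemma exp_remainder_le:
  fixes x y r :: real
  assumes "\<bar>x\<bar> \<le> r * y" "0 \<le> r" "r \<le> 1" "0 \<le> y"
  shows "exp x - 1 - x \<le> r\<^sup>2 * (exp y - 1 - y)"
proof -
  let ?f = "\<lambda>z::real. \<lambda>n. inverse (fact (n + 2)) * z ^ (n + 2)"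
  have rem: "?f z sums (exp z - 1 - z)" for z :: real
    using sums_split_initial_segment[OF exp_converges[of z], of 2]
    by (simp add: numeral_2_eq_2 algebra_simps)
  have "?f x n \<le> r\<^sup>2 * ?f y n" for n
  proof -
    have "x ^ (n + 2) \<le> (r * y) ^ (n + 2)"
      by (metis abs_ge_self abs_ge_zero assms(1) order_trans power_abs power_mono)
    also have "\<dots> = r\<^sup>2 * r ^ n * y ^ (n + 2)"
      by (simp add: power_mult_distrib power_add power2_eq_square mult_ac)
    also have "\<dots> \<le> r\<^sup>2 * 1 * y ^ (n + 2)"
      using assms by (intro mult_right_mono mult_left_mono power_le_one) auto
    finally have *: "x ^ (n + 2) \<le> r\<^sup>2 * y ^ (n + 2)" by simp
    have "inverse (fact (n + 2)) * x ^ (n + 2) \<le> inverse (fact (n + 2)) * (r\<^sup>2 * y ^ (n + 2))"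
      by (rule mult_left_mono[OF *]) simp
    thus ?thesis by (simp add: mult_ac)
  qed
  thus ?thesis
    by (intro sums_le[OF _ rem sums_mult[OF rem]]) auto
qed

lemma convex_on_power_nonneg: "convex_on {0::real..} (\<lambda>x. x ^ n)"
  by (metis convex_on_subset convex_power_even convex_power_odd subset_UNIV convex_real_interval(1))

text \<open>Jensen's inequality on each even term of the series: the squared root mean square is the
  average of the squares, and the terms of \<open>cosh\<close> are powers of squares with
  nonnegative coefficients.\<close>

lemma cosh_L2_set_le_average:
  fixes a :: "'i \<Rightarrow> real"
  assumes "finite I" "I \<noteq> {}"
  shows "cosh (L2_set a I / sqrt (card I)) \<le> (\<Sum>i\<in>I. cosh (a i)) / card I"
proof -
  let ?N = "real (card I)"
  let ?t = "\<lambda>x n. if even n then x ^ n /\<^sub>R fact n else (0::real)"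
  have N: "?N > 0" using assms by (simp add: card_gt_0_iff)
  let ?r = "L2_set a I / sqrt ?N"
  have r2: "?r\<^sup>2 = (\<Sum>i\<in>I. (1 / ?N) *\<^sub>R (a i)\<^sup>2)"
    using N by (simp add: power_divide L2_set_def sum_nonneg flip: sum_divide_distrib)
  have "(\<lambda>n. \<Sum>i\<in>I. ?t (a i) n) sums (\<Sum>i\<in>I. cosh (a i))"
    by (intro sums_sum cosh_converges)
  hence s: "(\<lambda>n. (\<Sum>i\<in>I. ?t (a i) n) / ?N) sums ((\<Sum>i\<in>I. cosh (a i)) / ?N)"
    by (rule sums_divide)
  have "?t ?r n \<le> (\<Sum>i\<in>I. ?t (a i) n) / ?N" for n
  proof (cases "even n")
    case True
    then obtain k where k: "n = 2 * k" by blast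
    have "?r ^ n = (?r\<^sup>2) ^ k" by (simp only: k power_mult)
    also have "\<dots> = (\<Sum>i\<in>I. (1 / ?N) *\<^sub>R (a i)\<^sup>2) ^ k" by (simp only: r2)
    also have "\<dots> \<le> (\<Sum>i\<in>I. (1 / ?N) * ((a i)\<^sup>2) ^ k)"
      using assms N by (intro convex_on_sum[OF _ _ convex_on_power_nonneg]) auto
    also have "\<dots> = (\<Sum>i\<in>I. a i ^ n) / ?N"
      by (simp add: k power_mult sum_divide_distrib)
    finally have "?r ^ n \<le> (\<Sum>i\<in>I. a i ^ n) / ?N" .
    hence "?r ^ n / fact n \<le> (\<Sum>i\<in>I. a i ^ n) / ?N / fact n"
      by (rule divide_right_mono) simp
    thus ?thesis using True
      by (simp add: divide_inverse mult_ac flip: sum_distrib_left)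
  qed auto
  thus ?thesis by (rule sums_le[OF _ cosh_converges s])
qed

lemma norm_matrix_eq_L2_set:
  fixes A :: "real^'n^'m"
  shows "norm A = L2_set (\<lambda>(i, j). A $ i $ j) UNIV"
  by (simp add: norm_vec_def L2_set_def sum_nonneg sum.cartesian_product case_prod_unfold flip: UNIV_Times_UNIV)

lemma cosh_norm_matrix_le:
  fixes A :: "real^'n^'n"
  shows "cosh (t * (norm A / CARD('n))) \<le>
           (\<Sum>(i, j)\<in>UNIV. cosh (t * A $ i $ j)) / (real CARD('n))\<^sup>2"
proof -
  have c: "card (UNIV :: ('n \<times> 'n) set) = CARD('n)\<^sup>2"
    by (simp add: power2_eq_square)
  \<comment> \<open>\<open>L2_set\<close> is nonnegative while \<open>t\<close> may be negative;
    evenness of \<open>cosh\<close> removes the absolute value again. The divisor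
    \<open>CARD('n)\<close> is the root of the number of entries.\<close>
  have "\<bar>t * norm A\<bar> = L2_set (\<lambda>(i, j). (t *\<^sub>R A) $ i $ j) UNIV"
    by (subst norm_matrix_eq_L2_set[symmetric]) (simp add: abs_mult)
  hence "cosh (\<bar>t * norm A\<bar> / CARD('n)) \<le> (\<Sum>p\<in>UNIV. cosh (case p of (i, j) \<Rightarrow> (t *\<^sub>R A) $ i $ j)) / (real CARD('n))\<^sup>2"
    using cosh_L2_set_le_average[of UNIV "\<lambda>(i, j). (t *\<^sub>R A) $ i $ j"] unfolding c
    by (simp add: real_sqrt_power)
  moreover have "cosh (\<bar>t * norm A\<bar> / CARD('n)) = cosh (t * (norm A / CARD('n)))"
    by (cases "0 \<le> t * norm A") (simp_all add: abs_if)
  ultimately show ?thesis by (simp add: case_prod_unfold)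
qed

lemma norm_matrix_vector_mult_le:
  fixes A :: "real^'n^'m"
  shows "norm (A *v x) \<le> norm A * norm x"
proof -
  have "norm (A *v x) \<le> L2_set (\<lambda>i. norm (A $ i) * norm x) UNIV"
    unfolding norm_vec_def[of "A *v x"]
    by (intro L2_set_mono) (auto simp: matrix_vector_mul_component Cauchy_Schwarz_ineq2)
  also have "\<dots> = norm A * norm x"
    by (simp add: norm_vec_def[of A] L2_set_left_distrib)
  finally show ?thesis .
qed

text \<open>A form of Jordan's inequality. For the half angle \<open>y\<close> it rests on
  \<open>y * cos y \<le> sin y\<close>, which follows by monotonicity from
  \<open>z * sin z \<ge> 0\<close>.\<close>

lemma arccos_le_sin:
  assumes "0 \<le> x" "x \<le> 1"
  shows "arccos x \<le> 2 * sqrt (1 - x\<^sup>2)"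
proof -
  define y where "y = arccos x / 2"
  have y: "0 \<le> y" "y \<le> pi / 4" and x: "cos (2 * y) = x"
    using assms arccos_le_pi2[of x] arccos_lbound[of x] by (auto simp: y_def)
  have "0 * cos 0 - sin 0 \<ge> y * cos y - sin y"
  proof (rule DERIV_nonpos_imp_nonincreasing[OF y(1)])
    fix z assume z: "0 \<le> z" "z \<le> y"
    have "((\<lambda>z. z * cos z - sin z) has_real_derivative - (z * sin z)) (at z)"
      by (auto intro!: derivative_eq_intros)
    moreover have "- (z * sin z) \<le> 0"
      using z y by (auto intro!: mult_nonneg_nonneg sin_ge_zero)
    ultimately show "\<exists>l. ((\<lambda>z. z * cos z - sin z) has_real_derivative l) (at z) \<and> l \<le> 0"
      by blast
  qed
  hence s: "y * cos y \<le> sin y" by simp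
  have c: "cos y \<ge> 0" using y by (intro cos_ge_zero) auto
  \<comment> \<open>The added term is nonnegative because \<open>cos (2 * y) = x\<close>; it
    supplies the second factor \<open>cos y\<close> needed to form
    \<open>sin (2 * y)\<close>.\<close>
  have "y \<le> y * (1 + cos (2 * y))"
    using y assms x by (simp add: algebra_simps)
  also have "\<dots> = 2 * (y * cos y) * cos y"
    by (simp add: cos_double_cos power2_eq_square)
  also have "\<dots> \<le> 2 * sin y * cos y"
    using s c by (intro mult_right_mono) auto
  also have "\<dots> = sin (arccos x)" by (simp add: y_def flip: sin_double)
  also have "\<dots> = sqrt (1 - x\<^sup>2)" using assms by (simp add: sin_arccos_abs)
  finally show ?thesis by (simp add: y_def)
qed

subsection \<open>Spectral gap and perturbation of maximal directions\<close>

lemma symmetric_inner_eq: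
  fixes A :: "real^'n^'n"
  assumes "transpose A = A"
  shows "(A *v x) \<bullet> y = x \<bullet> (A *v y)"
  using dot_lmul_matrix[of x A y] vector_transpose_matrix[of x A] assms by simp

text \<open>Applied to the whole space and then to the orthogonal complement of the first maximiser,
  this produces the two eigenvectors on which the spectral gap rests.\<close>

lemma maximiser_on_invariant_subspace_eigenvector:
  fixes A :: "real^'n^'n"
  assumes sym: "transpose A = A"
    and T: "subspace T" "\<And>x. x \<in> T \<Longrightarrow> A *v x \<in> T"
    and u: "u \<in> T" "norm u = 1"
    and max: "\<And>x. x \<in> T \<Longrightarrow> norm x = 1 \<Longrightarrow> (A *v x) \<bullet> x \<le> (A *v u) \<bullet> u"
  shows "A *v u = ((A *v u) \<bullet> u) *\<^sub>R u"
proof -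
  define m where "m = (A *v u) \<bullet> u"
  \<comment> \<open>The form \<open>m \<bar>y\<bar>\<^sup>2 - \<langle>A y, y\<rangle>\<close> is nonnegative on \<open>T\<close> and vanishes at \<open>u\<close>, so its derivative at \<open>u\<close>
    in the direction of its own gradient \<open>x\<close>, which is \<open>2 \<langle>x, x\<rangle>\<close>, is zero.\<close>
  define x where "x = m *\<^sub>R u - A *v u"
  define b where "b = m * (norm x)\<^sup>2 - (A *v x) \<bullet> x"
  have uu: "u \<bullet> u = 1" using u by (simp add: dot_square_norm)
  have xT: "x \<in> T" using T u by (auto simp: x_def intro: subspace_diff subspace_scale)
  have le: "(A *v y) \<bullet> y \<le> m * (norm y)\<^sup>2" if "y \<in> T" for y
  proof (cases "y = 0")
    case False
    let ?y = "(1 / norm y) *\<^sub>R y"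
    have "(A *v ?y) \<bullet> ?y \<le> m"
      using False that T(1) unfolding m_def by (intro max) (auto intro: subspace_scale)
    hence "((A *v y) \<bullet> y) / (norm y)\<^sup>2 \<le> m"
      by (simp add: matrix_vector_mult_scaleR power2_eq_square)
    thus ?thesis using False by (simp add: field_simps)
  qed simp
  have q: "0 \<le> 2 * t * (x \<bullet> x) + t\<^sup>2 * b" for t
  proof -
    have "(A *v (u + t *\<^sub>R x)) \<bullet> (u + t *\<^sub>R x) \<le> m * (norm (u + t *\<^sub>R x))\<^sup>2"
      using T u xT by (intro le) (auto intro: subspace_add subspace_scale)
    also have "(norm (u + t *\<^sub>R x))\<^sup>2 = 1 + 2 * t * (u \<bullet> x) + t\<^sup>2 * (norm x)\<^sup>2"
      unfolding power2_norm_eq_inner by (simp add: uu inner_add_left inner_add_right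
          power2_eq_square inner_commute algebra_simps)
    also have "(A *v (u + t *\<^sub>R x)) \<bullet> (u + t *\<^sub>R x)
        = m + 2 * t * ((A *v u) \<bullet> x) + t\<^sup>2 * ((A *v x) \<bullet> x)"
      using symmetric_inner_eq[OF sym, of x u]
      by (simp add: matrix_vector_right_distrib matrix_vector_mult_scaleR inner_add_left
          inner_add_right m_def power2_eq_square inner_commute algebra_simps)
    finally have *: "m + 2 * t * ((A *v u) \<bullet> x) + t\<^sup>2 * ((A *v x) \<bullet> x)
        \<le> m * (1 + 2 * t * (u \<bullet> x) + t\<^sup>2 * (norm x)\<^sup>2)" .
    have "(A *v u) \<bullet> x = m * (u \<bullet> x) - x \<bullet> x"
      by (subst (3) x_def) (simp add: inner_diff_left)
    from *[unfolded this] show ?thesis by (simp add: b_def algebra_simps)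
  qed
  have "x \<bullet> x = 0"
  proof (rule ccontr)
    assume "x \<bullet> x \<noteq> 0"
    hence p: "x \<bullet> x > 0" by (simp add: order_less_le)
    \<comment> \<open>This choice gives \<open>t * b \<le> x \<bullet> x\<close>, so at
      \<open>- t\<close> the negative linear term in \<open>q\<close> outweighs the quadratic
      one.\<close>
    define t where "t = (x \<bullet> x) / (\<bar>b\<bar> + 1)"
    have t: "t > 0" using p by (simp add: t_def)
    have "t * b \<le> t * (\<bar>b\<bar> + 1)" using t by (intro mult_left_mono) auto
    also have "\<dots> = x \<bullet> x" by (simp add: t_def add_nonneg_eq_0_iff)
    finally have "t * (t * b) \<le> t * (x \<bullet> x)" using t by simp
    moreover have "0 < t * (x \<bullet> x)" using t p by simp
    ultimately show False using q[of "- t"] by (simp add: power2_eq_square)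
  qed
  thus ?thesis by (simp add: x_def m_def)
qed

lemma maximiser_on_subspace_exists:
  fixes A :: "real^'n^'n"
  assumes "subspace T" "T \<noteq> {0}"
  obtains u where "u \<in> T" "norm u = 1"
    "\<And>x. x \<in> T \<Longrightarrow> norm x = 1 \<Longrightarrow> (A *v x) \<bullet> x \<le> (A *v u) \<bullet> u"
proof -
  from assms obtain z where z: "z \<in> T" "z \<noteq> 0" using subspace_0 by blast
  hence "(1 / norm z) *\<^sub>R z \<in> T \<inter> sphere 0 1"
    using assms by (auto intro: subspace_scale)
  hence "T \<inter> sphere 0 1 \<noteq> {}" by blast
  moreover have "compact (T \<inter> sphere 0 1)"
    using assms by (intro closed_Int_compact closed_subspace) auto
  moreover have "continuous_on (T \<inter> sphere 0 1) (\<lambda>x. (A *v x) \<bullet> x)"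
    by (intro continuous_intros)
  ultimately obtain u where "u \<in> T \<inter> sphere 0 1" "\<forall>y\<in>T \<inter> sphere 0 1. (A *v y) \<bullet> y \<le> (A *v u) \<bullet> u"
    using continuous_attains_sup by blast
  thus thesis by (intro that[of u]) auto
qed

lemma eigenvalue_iff_listed:
  assumes "eigenvalues_desc (A :: real^'n^'n) lam"
  shows "(\<exists>i\<in>{1..CARD('n)}. lam i = t) \<longleftrightarrow> (\<exists>v. v \<noteq> 0 \<and> A *v v = t *\<^sub>R v)"
proof -
  have "(\<exists>i\<in>{1..CARD('n)}. lam i = t) \<longleftrightarrow> card {i \<in> {1..CARD('n)}. lam i = t} \<noteq> 0"
    by (auto simp: card_eq_0_iff)
  also have "\<dots> \<longleftrightarrow> dim {v. A *v v = t *\<^sub>R v} \<noteq> 0"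
    using assms by (simp add: eigenvalues_desc_def)
  also have "\<dots> \<longleftrightarrow> (\<exists>v. v \<noteq> 0 \<and> A *v v = t *\<^sub>R v)"
    by (auto simp: dim_eq_0)
  finally show ?thesis .
qed

text \<open>Maximising the form on the whole space gives an eigenvector \<open>u\<close> for
  \<open>lam 1\<close>; maximising it on the complement of \<open>u\<close> gives an eigenvalue at
  most \<open>lam 2\<close>. Splitting \<open>x\<close> along \<open>u\<close> and its complement
  combines the two.\<close>

lemma spectral_gap:
  fixes A :: "real^'n^'n"
  assumes sym: "transpose A = A" and card: "CARD('n) \<ge> 2"
    and eig: "eigenvalues_desc A lam" and gap: "lam 1 > lam 2"
  obtains u where "norm u = 1" "(A *v u) \<bullet> u = lam 1"
    "\<And>x. norm x = 1 \<Longrightarrow> (A *v x) \<bullet> x \<le> lam 1 - (lam 1 - lam 2) * (1 - (x \<bullet> u)\<^sup>2)"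
proof -
  note anti = eig[unfolded eigenvalues_desc_def, THEN conjunct1, THEN monotone_onD]
  have "DIM(real^'n) \<ge> 2" using card by simp
  hence nz: "(UNIV :: (real^'n) set) \<noteq> {0}" using dim_UNIV[where 'a="real^'n"]
    by (metis dim_eq_0 not_numeral_le_zero order_refl)
  obtain u where u: "norm u = 1" and umax: "\<And>x. norm x = 1 \<Longrightarrow> (A *v x) \<bullet> x \<le> (A *v u) \<bullet> u"
    by (rule maximiser_on_subspace_exists[OF subspace_UNIV nz, of A]) auto
  define m where "m = (A *v u) \<bullet> u"
  have uu: "u \<bullet> u = 1" and unz: "u \<noteq> 0" using u by (auto simp: dot_square_norm)
  have Au: "A *v u = m *\<^sub>R u" unfolding m_def
    by (rule maximiser_on_invariant_subspace_eigenvector[OF sym subspace_UNIV]) (use u umax in auto)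
  \<comment> \<open>\<open>m\<close> is an eigenvalue, hence listed and at most the first entry;
    conversely, a normalised eigenvector for \<open>lam 1\<close> competes in the
    maximisation.\<close>
  have m: "m = lam 1"
  proof (rule antisym)
    obtain i where "i \<in> {1..CARD('n)}" "lam i = m"
      using Au unz eigenvalue_iff_listed[OF eig] by blast
    thus "m \<le> lam 1" using anti[of 1 i] card by auto
    obtain v where v: "v \<noteq> 0" "A *v v = lam 1 *\<^sub>R v"
      using eigenvalue_iff_listed[OF eig, of "lam 1"] card by force
    let ?v = "(1 / norm v) *\<^sub>R v"
    have "(A *v ?v) \<bullet> ?v = lam 1"
      using v by (simp add: matrix_vector_mult_scaleR dot_square_norm power2_eq_square)
    thus "lam 1 \<le> m" using umax[of ?v] v unfolding m_def by simp
  qed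
  define T where "T = {x. u \<bullet> x = 0}"
  have T: "subspace T" by (simp add: T_def subspace_hyperplane)
  have Tinv: "A *v x \<in> T" if "x \<in> T" for x
    using that symmetric_inner_eq[OF sym, of u x] by (simp add: T_def Au)
  have "dim T = CARD('n) - 1" unfolding T_def using unz by (simp add: dim_hyperplane)
  hence "T \<noteq> {0}" using card by (auto simp: dim_eq_0)
  then obtain w where w: "w \<in> T" "norm w = 1"
    and wmax: "\<And>x. x \<in> T \<Longrightarrow> norm x = 1 \<Longrightarrow> (A *v x) \<bullet> x \<le> (A *v w) \<bullet> w"
    by (rule maximiser_on_subspace_exists[OF T, of A]) auto
  define m2 where "m2 = (A *v w) \<bullet> w"
  have Aw: "A *v w = m2 *\<^sub>R w" unfolding m2_def
    by (rule maximiser_on_invariant_subspace_eigenvector[OF sym T Tinv]) (use w wmax in auto)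
  have wnz: "w \<noteq> 0" and uw: "u \<bullet> w = 0" using w by (auto simp: T_def)
  obtain i where i: "i \<in> {1..CARD('n)}" "lam i = m2"
    using Aw wnz eigenvalue_iff_listed[OF eig] by blast
  \<comment> \<open>Otherwise \<open>u\<close> and \<open>w\<close> would span a plane of eigenvectors for \<open>lam 1\<close>, contradicting the gap.\<close>
  have "m2 \<le> lam 2"
  proof (cases "i = 1")
    case True
    hence m2: "m2 = lam 1" using i by simp
    have ne: "u \<noteq> w" using uu uw by auto
    have "pairwise orthogonal {u, w}" using uw by (auto simp: pairwise_def orthogonal_def inner_commute)
    hence ind: "independent {u, w}" using unz wnz by (intro pairwise_orthogonal_independent) auto
    have "{u, w} \<subseteq> {v. A *v v = lam 1 *\<^sub>R v}" using Au Aw m m2 by auto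
    hence "dim {u, w} \<le> dim {v. A *v v = lam 1 *\<^sub>R v}" by (rule dim_subset)
    moreover have "dim {u, w} = 2" using dim_eq_card_independent[OF ind] ne by simp
    ultimately have "2 \<le> card {i \<in> {1..CARD('n)}. lam i = lam 1}"
      using eig by (simp add: eigenvalues_desc_def)
    moreover have "{i \<in> {1..CARD('n)}. lam i = lam 1} \<subseteq> {1}"
    proof
      fix j assume j: "j \<in> {i \<in> {1..CARD('n)}. lam i = lam 1}"
      \<comment> \<open>From index 2 on, the values are at most \<open>lam 2\<close>, hence below
        \<open>lam 1\<close>.\<close>
      have "j \<le> 1" using anti[of 2 j] j gap card by fastforce
      thus "j \<in> {1}" using j by auto
    qed
    hence "card {i \<in> {1..CARD('n)}. lam i = lam 1} \<le> card {1::nat}" by (intro card_mono) auto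
    ultimately show ?thesis by simp
  next
    case False
    thus ?thesis using anti[of 2 i] i card by auto
  qed
  show thesis
  proof (rule that[OF u])
    show "(A *v u) \<bullet> u = lam 1" using m by (simp add: m_def)
    fix x :: "real^'n" assume x: "norm x = 1"
    define a where "a = x \<bullet> u"
    define y where "y = x - a *\<^sub>R u"
    have yu: "u \<bullet> y = 0" "y \<bullet> u = 0" by (simp_all add: y_def a_def inner_diff_right inner_diff_left uu inner_commute)
    have xy: "x = a *\<^sub>R u + y" by (simp add: y_def)
    have "x \<bullet> x = 1" using x by (simp add: dot_square_norm)
    hence ny: "y \<bullet> y = 1 - a\<^sup>2"
      by (simp add: y_def a_def inner_diff_right inner_diff_left uu inner_commute
          power2_eq_square algebra_simps)
    have "(A *v y) \<bullet> y \<le> m2 * (y \<bullet> y)"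
    proof (cases "y = 0")
      case False
      have "((1 / norm y) *\<^sub>R y) \<in> T" using yu by (simp add: T_def)
      from wmax[OF this] False have "((A *v y) \<bullet> y) / (y \<bullet> y) \<le> m2"
        by (simp add: matrix_vector_mult_scaleR m2_def dot_square_norm power2_eq_square)
      thus ?thesis using False by (simp add: field_simps order_less_le)
    qed simp
    also have "\<dots> \<le> lam 2 * (y \<bullet> y)" using \<open>m2 \<le> lam 2\<close> by (intro mult_right_mono) auto
    finally have "(A *v y) \<bullet> y \<le> lam 2 * (1 - a\<^sup>2)" by (simp add: ny)
    moreover have "(A *v x) \<bullet> x = m * a\<^sup>2 + (A *v y) \<bullet> y"
    proof -
      \<comment> \<open>The cross terms vanish because the complement of \<open>u\<close> is
        invariant under \<open>A\<close>.\<close>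
      have "(A *v y) \<bullet> u = 0" using symmetric_inner_eq[OF sym, of y u] by (simp add: Au yu)
      thus ?thesis unfolding xy
        by (simp add: matrix_vector_right_distrib matrix_vector_mult_scaleR inner_add_left
          inner_add_right Au yu uu power2_eq_square)
    qed
    ultimately show "(A *v x) \<bullet> x \<le> lam 1 - (lam 1 - lam 2) * (1 - (x \<bullet> u)\<^sup>2)"
      by (simp add: m a_def algebra_simps)
  qed
qed

section \<open>Maximal directions and their angular deviation\<close>

lemma max_directions_iff:
  "\<phi> \<in> max_directions A \<longleftrightarrow>
     norm \<phi> = 1 \<and> (\<forall>x. norm x = 1 \<longrightarrow> (A *v x) \<bullet> x \<le> (A *v \<phi>) \<bullet> \<phi>)"
  by (auto simp: max_directions_def is_arg_max_def not_less)

lemma max_directions_nonempty: "max_directions A \<noteq> {}"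
proof -
  have "(UNIV :: (real^'n) set) \<noteq> {0}"
    by (metis UNIV_I norm_zero singletonD vector_choose_size zero_le_one zero_neq_one)
  from maximiser_on_subspace_exists[OF subspace_UNIV this, of A] show ?thesis
    by (metis UNIV_I empty_iff max_directions_iff)
qed

lemma inner_unit_eq_1_iff:
  fixes x u :: "'a::real_inner"
  assumes "norm x = 1" "norm u = 1"
  shows "x \<bullet> u = 1 \<longleftrightarrow> x = u"
  using norm_cauchy_schwarz_eq[of x u] assms by (auto simp: dot_square_norm)

text \<open>At a maximiser the deficit \<open>g * (1 - (x \<bullet> u)\<^sup>2)\<close> must vanish,
  which is the equality case of Cauchy-Schwarz.\<close>

lemma max_directions_spectral_gap:
  fixes A :: "real^'n^'n"
  assumes u: "norm u = 1" "(A *v u) \<bullet> u = l1" and gap: "g > 0"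
    and le: "\<And>x. norm x = 1 \<Longrightarrow> (A *v x) \<bullet> x \<le> l1 - g * (1 - (x \<bullet> u)\<^sup>2)"
  shows "max_directions A = {u, - u}"
proof -
  have le1: "(x \<bullet> u)\<^sup>2 \<le> 1" if "norm x = 1" for x
    using Cauchy_Schwarz_ineq2[of x u] that u by (simp add: abs_square_le_1)
  have le': "(A *v x) \<bullet> x \<le> l1" if "norm x = 1" for x
    using le[OF that] le1[OF that] gap mult_nonneg_nonneg[of g "1 - (x \<bullet> u)\<^sup>2"] by linarith
  have "x = u \<or> x = - u" if "x \<in> max_directions A" for x
  proof -
    have x: "norm x = 1" "l1 \<le> (A *v x) \<bullet> x" using that u by (auto simp: max_directions_iff)
    hence "g * (1 - (x \<bullet> u)\<^sup>2) \<le> 0" using le[of x] by simp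
    hence "(x \<bullet> u)\<^sup>2 = 1" using le1[of x] x gap by (simp add: mult_le_0_iff)
    hence "x \<bullet> u = 1 \<or> x \<bullet> (- u) = 1" by (auto simp: power2_eq_1_iff)
    thus ?thesis using inner_unit_eq_1_iff[of x u] inner_unit_eq_1_iff[of x "- u"] x u by auto
  qed
  moreover have "(A *v (- u)) \<bullet> (- u) = l1" using u(2)
    by (simp add: linear_neg[OF matrix_vector_mul_linear])
  hence "u \<in> max_directions A" "- u \<in> max_directions A"
    using u le' by (auto simp only: max_directions_iff norm_minus_cancel)
  ultimately show ?thesis by blast
qed

text \<open>Since \<open>arccos\<close> decreases, the nearer of two antipodal points is the one
  with nonnegative inner product; the distance becomes an angle between lines.\<close>

lemma INF_gc_dist_antipodal:
  assumes "norm \<phi> = 1" "norm u = 1"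
  shows "(INF \<psi>\<in>{u, - u}. gc_dist \<phi> \<psi>) = arccos \<bar>\<phi> \<bullet> u\<bar>"
proof -
  have "\<bar>\<phi> \<bullet> u\<bar> \<le> 1" using Cauchy_Schwarz_ineq2[of \<phi> u] assms by simp
  hence "inf (arccos (\<phi> \<bullet> u)) (arccos (- (\<phi> \<bullet> u))) = arccos \<bar>\<phi> \<bullet> u\<bar>"
    by (cases "\<phi> \<bullet> u \<ge> 0") (auto simp: inf_min min_def intro!: antisym arccos_le_arccos)
  thus ?thesis by (simp add: gc_dist_def cInf_insert)
qed

lemma gc_dev_antipodal_eq:
  assumes "norm u = 1"
  shows "gc_dev (max_directions A) {u, - u} = (SUP \<phi>\<in>max_directions A. arccos \<bar>\<phi> \<bullet> u\<bar>)"
  unfolding gc_dev_def using assms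
  by (intro SUP_cong refl INF_gc_dist_antipodal) (auto simp: max_directions_iff)

lemma arccos_inner_bounds:
  assumes "norm u = 1" "norm \<phi> = 1"
  shows "0 \<le> arccos \<bar>\<phi> \<bullet> u\<bar>" "arccos \<bar>\<phi> \<bullet> u\<bar> \<le> pi"
  using Cauchy_Schwarz_ineq2[of \<phi> u] assms by (auto intro: arccos_lbound arccos_ubound)

lemma bdd_above_arccos_inner:
  assumes "norm u = 1"
  shows "bdd_above ((\<lambda>\<phi>. arccos \<bar>\<phi> \<bullet> u\<bar>) ` max_directions A)"
  using arccos_inner_bounds[OF assms] by (intro bdd_aboveI2[of _ _ pi]) (auto simp: max_directions_iff)

lemma gc_dev_max_directions_nonneg:
  assumes "norm u = 1"
  shows "0 \<le> gc_dev (max_directions A) {u, - u}"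
proof -
  obtain \<phi> where "\<phi> \<in> max_directions A" using max_directions_nonempty by blast
  thus ?thesis unfolding gc_dev_antipodal_eq[OF assms]
    using arccos_inner_bounds[OF assms] bdd_above_arccos_inner[OF assms]
    by (intro cSUP_upper2) (auto simp: max_directions_iff)
qed

lemma gc_dev_le_norm_perturbation:
  fixes A B :: "real^'n^'n"
  assumes sym: "transpose A = A" "transpose B = B"
    and u: "norm u = 1" "(A *v u) \<bullet> u = l1" and gap: "g > 0"
    and le: "\<And>x. norm x = 1 \<Longrightarrow> (A *v x) \<bullet> x \<le> l1 - g * (1 - (x \<bullet> u)\<^sup>2)"
  shows "gc_dev (max_directions B) {u, - u} \<le> 4 / g * norm (B - A)"
  unfolding gc_dev_antipodal_eq[OF u(1)]
proof (rule cSUP_least[OF max_directions_nonempty])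
  fix \<phi> assume "\<phi> \<in> max_directions B"
  hence \<phi>: "norm \<phi> = 1" and max: "(B *v u) \<bullet> u \<le> (B *v \<phi>) \<bullet> \<phi>"
    using u by (auto simp: max_directions_iff)
  let ?D = "B - A"
  define x where "x = \<phi> \<bullet> u"
  have x: "\<bar>x\<bar> \<le> 1" using Cauchy_Schwarz_ineq2[of \<phi> u] \<phi> u by (simp add: x_def)
  have x2: "x\<^sup>2 \<le> 1" using x by (simp add: abs_square_le_1)
  \<comment> \<open>The sine of the angle between the lines spanned by \<open>\<phi>\<close> and
    \<open>u\<close>.\<close>
  define s where "s = sqrt (1 - x\<^sup>2)"
  have s: "s \<ge> 0" "s\<^sup>2 = 1 - x\<^sup>2" using x2 by (auto simp: s_def)
  have symD: "transpose ?D = ?D" using sym by (simp add: transpose_def vec_eq_iff)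
  \<comment> \<open>The gap of \<open>A\<close> at \<open>\<phi>\<close> is combined with the
    maximality of \<open>\<phi>\<close> for \<open>B\<close>.\<close>
  have "g * s\<^sup>2 \<le> (?D *v \<phi>) \<bullet> \<phi> - (?D *v u) \<bullet> u"
    using le[OF \<phi>] max u(2) by (simp add: s x_def matrix_vector_mult_diff_rdistrib inner_diff_left)
  \<comment> \<open>A difference of squares for quadratic forms; symmetry of \<open>B - A\<close>
    cancels the cross terms.\<close>
  also have "\<dots> = (?D *v (\<phi> - u)) \<bullet> (\<phi> + u)"
    using symmetric_inner_eq[OF symD, of \<phi> u]
    by (simp add: matrix_vector_mult_diff_distrib inner_diff_left inner_add_right
        inner_add_left inner_diff_right inner_commute)
  also have "\<dots> \<le> norm (?D *v (\<phi> - u)) * norm (\<phi> + u)" by (rule norm_cauchy_schwarz)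
  also have "\<dots> \<le> norm ?D * norm (\<phi> - u) * norm (\<phi> + u)"
    by (intro mult_right_mono norm_matrix_vector_mult_le) auto
  also have "norm ?D * norm (\<phi> - u) * norm (\<phi> + u) = norm ?D * (2 * s)"
  proof -
    have *: "(norm (\<phi> - u))\<^sup>2 = 2 - 2 * x" "(norm (\<phi> + u))\<^sup>2 = 2 + 2 * x"
      using \<phi> u unfolding power2_norm_eq_inner
      by (simp_all add: inner_diff_left inner_diff_right inner_add_left inner_add_right x_def
          inner_commute norm_eq_1)
    have "(norm (\<phi> - u) * norm (\<phi> + u))\<^sup>2 = (2 * s)\<^sup>2"
      unfolding power_mult_distrib * s(2) by (simp add: power2_eq_square algebra_simps)
    hence "norm (\<phi> - u) * norm (\<phi> + u) = 2 * s" using s by (subst (asm) power2_eq_iff_nonneg) auto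
    thus ?thesis by (simp add: mult.assoc)
  qed
  finally have "s * (g * s) \<le> s * (2 * norm ?D)" by (simp add: power2_eq_square mult_ac)
  \<comment> \<open>Cancelling one factor \<open>s\<close> leaves a bound linear in the
    perturbation.\<close>
  hence "g * s \<le> 2 * norm ?D" using s(1) by (cases "s = 0") auto
  hence "s \<le> 2 * norm ?D / g" using gap by (simp add: field_simps)
  moreover have "arccos \<bar>x\<bar> \<le> 2 * s" using arccos_le_sin[of "\<bar>x\<bar>"] x by (simp add: s_def)
  ultimately show "arccos \<bar>\<phi> \<bullet> u\<bar> \<le> 4 / g * norm ?D" by (simp add: x_def)
qed

text \<open>Maximisers need not be unique or depend continuously on the matrix, so measurability is
  read off from superlevel sets.\<close>

lemma borel_measurable_gc_dev_max_directions:
  fixes u :: "real^'n"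
  assumes u: "norm u = 1"
  shows "(\<lambda>A. gc_dev (max_directions A) {u, - u}) \<in> borel_measurable borel"
proof (rule borel_measurableI_greater)
  fix y :: real
  let ?f = "\<lambda>\<phi>. arccos (min 1 \<bar>\<phi> \<bullet> u\<bar>)"
  \<comment> \<open>Each superlevel set is a countable union of projections, along the compact sphere, of closed
    sets of pairs. The minimum only serves to make \<open>arccos\<close> continuous off the sphere.\<close>
  define T :: "nat \<Rightarrow> ((real^'n) \<times> (real^'n^'n)) set" where
    "T k = {p. y + 1 / Suc k \<le> ?f (fst p)} \<inter>
       (\<Inter>x\<in>sphere 0 1. {p. (snd p *v x) \<bullet> x \<le> (snd p *v fst p) \<bullet> fst p})" for k
  have "closed (T k)" for k
  proof -
    have "continuous_on UNIV (\<lambda>p. ?f (fst p))"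
      by (intro continuous_intros) auto
    moreover have "continuous_on UNIV (\<lambda>p::(real^'n) \<times> (real^'n^'n). (snd p *v fst p) \<bullet> fst p)"
      "\<And>x. continuous_on UNIV (\<lambda>p::(real^'n) \<times> (real^'n^'n). (snd p *v x) \<bullet> x)"
      unfolding matrix_vector_mult_def by (intro continuous_intros)+
    ultimately show ?thesis unfolding T_def
      by (intro closed_Int closed_INT ballI closed_Collect_le) auto
  qed
  hence cl: "closed {A. \<exists>\<phi>. \<phi> \<in> sphere 0 1 \<and> (\<phi>, A) \<in> T k}" for k
    by (intro closed_compact_projection) auto
  have f: "?f \<phi> = arccos \<bar>\<phi> \<bullet> u\<bar>" if "norm \<phi> = 1" for \<phi>
    using Cauchy_Schwarz_ineq2[of \<phi> u] that u by (simp add: min_def)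
  \<comment> \<open>The margin \<open>1 / Suc k\<close> replaces a strict inequality by countably
    many closed conditions.\<close>
  have gt: "y < z \<longleftrightarrow> (\<exists>k. y + 1 / Suc k \<le> z)" for z :: real
  proof
    assume "y < z"
    then obtain k where "1 / Suc k < z - y" using nat_approx_posE[of "z - y"] by auto
    thus "\<exists>k. y + 1 / Suc k \<le> z" by (intro exI[of _ k]) simp
  next
    assume "\<exists>k. y + 1 / Suc k \<le> z"
    then obtain k where "y + 1 / Suc k \<le> z" ..
    moreover have "1 / real (Suc k) > 0" by simp
    ultimately show "y < z" by linarith
  qed
  have "{A. y < gc_dev (max_directions A) {u, - u}} =
      (\<Union>k. {A. \<exists>\<phi>. \<phi> \<in> sphere 0 1 \<and> (\<phi>, A) \<in> T k})"
  proof (rule set_eqI)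
    fix A :: "real^'n^'n"
    have "A \<in> {A. y < gc_dev (max_directions A) {u, - u}} \<longleftrightarrow>
        (\<exists>\<phi>\<in>max_directions A. \<exists>k. y + 1 / Suc k \<le> arccos \<bar>\<phi> \<bullet> u\<bar>)"
      by (simp only: mem_Collect_eq gc_dev_antipodal_eq[OF u]
          less_cSUP_iff[OF max_directions_nonempty bdd_above_arccos_inner[OF u]] gt)
    also have "\<dots> \<longleftrightarrow> (\<exists>k. \<exists>\<phi>. \<phi> \<in> sphere 0 1 \<and> (\<phi>, A) \<in> T k)"
      using f unfolding T_def Bex_def max_directions_iff by (fastforce simp del: of_nat_Suc)
    finally show "A \<in> {A. y < gc_dev (max_directions A) {u, - u}} \<longleftrightarrow>
        A \<in> (\<Union>k. {A. \<exists>\<phi>. \<phi> \<in> sphere 0 1 \<and> (\<phi>, A) \<in> T k})" by blast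
  qed
  thus "{A \<in> space borel. y < gc_dev (max_directions A) {u, - u}} \<in> sets borel"
    using cl by auto
qed

subsection \<open>Exponential moments\<close>

text \<open>The second-order remainder of \<open>exp (s * Y x)\<close> is at most
  \<open>s\<^sup>2 * k\<^sup>2\<close> times that of \<open>exp (\<bar>Y x\<bar> / k)\<close>, whose
  mean is at most 1. The linear term is absorbed by centring at the end.\<close>

lemma (in prob_space) exp_moment_centered_le:
  fixes Y :: "'a \<Rightarrow> real"
  assumes Y: "Y \<in> borel_measurable M" and k: "k > 0"
    and int: "integrable M (\<lambda>x. exp (\<bar>Y x\<bar> / k))" and le: "expectation (\<lambda>x. exp (\<bar>Y x\<bar> / k)) \<le> 2"
    and s: "\<bar>s\<bar> \<le> 1 / k"
  shows "integrable M (\<lambda>x. exp (s * (Y x - expectation Y)))"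
    and "expectation (\<lambda>x. exp (s * (Y x - expectation Y))) \<le> exp (s\<^sup>2 * k\<^sup>2)"
proof -
  note [measurable] = Y
  have "norm (Y x) \<le> k * exp (\<bar>Y x\<bar> / k)" for x
  proof -
    have "\<bar>Y x\<bar> / k \<le> exp (\<bar>Y x\<bar> / k)" using exp_ge_add_one_self[of "\<bar>Y x\<bar> / k"] by linarith
    thus ?thesis using k by (simp add: field_simps)
  qed
  hence intY: "integrable M Y"
    by (intro Bochner_Integration.integrable_bound[OF integrable_mult_right[OF int, of k]])
       (auto intro!: AE_I2 order_trans[OF _ abs_ge_self])
  hence intA: "integrable M (\<lambda>x. \<bar>Y x\<bar>)" by simp
  have sY: "\<bar>s * Y x\<bar> \<le> \<bar>s * k\<bar> * (\<bar>Y x\<bar> / k)" for x using k by (simp add: abs_mult)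
  have sk: "\<bar>s * k\<bar> \<le> 1" using s k by (simp add: abs_mult field_simps)
  have "s * Y x \<le> \<bar>Y x\<bar> / k" for x
    using sY[of x] mult_right_mono[OF sk, of "\<bar>Y x\<bar> / k"] k by fastforce
  hence intE: "integrable M (\<lambda>x. exp (s * Y x))"
    by (intro Bochner_Integration.integrable_bound[OF int]) auto
  have eq: "exp (s * (Y x - expectation Y)) = exp (- (s * expectation Y)) * exp (s * Y x)" for x
    by (simp add: algebra_simps flip: exp_add)
  show "integrable M (\<lambda>x. exp (s * (Y x - expectation Y)))"
    unfolding eq by (intro integrable_mult_right intE)
  let ?R = "\<lambda>x. 1 + s * Y x + s\<^sup>2 * k\<^sup>2 * (exp (\<bar>Y x\<bar> / k) - 1 - \<bar>Y x\<bar> / k)"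
  have "exp (s * Y x) \<le> ?R x" for x
    using exp_remainder_le[OF sY _ sk, of x] k by (simp add: power_mult_distrib)
  hence "expectation (\<lambda>x. exp (s * Y x)) \<le> expectation ?R"
    by (intro integral_mono intE) (use intY intA int in auto)
  also have "\<dots> = 1 + s * expectation Y
      + s\<^sup>2 * k\<^sup>2 * (expectation (\<lambda>x. exp (\<bar>Y x\<bar> / k)) - 1 - expectation (\<lambda>x. \<bar>Y x\<bar>) / k)"
    using intY intA int by (simp add: prob_space)
  \<comment> \<open>The bracket is at most \<open>2 - 1\<close>, since the subtracted mean of
    \<open>\<bar>Y x\<bar> / k\<close> is nonnegative.\<close>
  also have "\<dots> \<le> 1 + s * expectation Y + s\<^sup>2 * k\<^sup>2 * 1"
  proof -
    have "0 \<le> expectation (\<lambda>x. \<bar>Y x\<bar>) / k" using k by simp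
    thus ?thesis using le by (intro add_left_mono mult_left_mono) auto
  qed
  also have "\<dots> \<le> exp (s * expectation Y + s\<^sup>2 * k\<^sup>2)"
    using exp_ge_add_one_self[of "s * expectation Y + s\<^sup>2 * k\<^sup>2"] by (simp add: add.assoc)
  finally have "exp (- (s * expectation Y)) * expectation (\<lambda>x. exp (s * Y x))
      \<le> exp (- (s * expectation Y)) * exp (s * expectation Y + s\<^sup>2 * k\<^sup>2)"
    by (intro mult_left_mono) auto
  also have "\<dots> = exp (s\<^sup>2 * k\<^sup>2)" by (simp flip: exp_add)
  finally show "expectation (\<lambda>x. exp (s * (Y x - expectation Y))) \<le> exp (s\<^sup>2 * k\<^sup>2)"
    unfolding eq by simp
qed

text \<open>With \<open>s = t / n\<close> the exponential factors over the independent terms. Each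
  factor contributes \<open>t\<^sup>2 * k\<^sup>2 / n\<^sup>2\<close> to the exponent, and
  \<open>\<bar>t\<bar> \<le> n / k\<close> is the admissible range of \<open>s\<close>.\<close>

lemma (in prob_space) exp_moment_average_le:
  fixes Y :: "nat \<Rightarrow> 'a \<Rightarrow> real"
  assumes indep: "indep_vars (\<lambda>_. borel) Y {1..n}" and n: "n \<ge> 1" and k: "k > 0"
    and int: "\<And>i. i \<in> {1..n} \<Longrightarrow> integrable M (\<lambda>x. exp (\<bar>Y i x\<bar> / k))"
    and le: "\<And>i. i \<in> {1..n} \<Longrightarrow> expectation (\<lambda>x. exp (\<bar>Y i x\<bar> / k)) \<le> 2"
    and mean: "\<And>i. i \<in> {1..n} \<Longrightarrow> expectation (Y i) = m"
    and t: "\<bar>t\<bar> \<le> n / k"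
  shows "integrable M (\<lambda>x. exp (t * ((\<Sum>i\<in>{1..n}. Y i x) / n - m)))"
    and "expectation (\<lambda>x. exp (t * ((\<Sum>i\<in>{1..n}. Y i x) / n - m))) \<le> exp (t\<^sup>2 * k\<^sup>2 / n)"
proof -
  define s where "s = t / n"
  have s: "\<bar>s\<bar> \<le> 1 / k" using t n k by (simp add: s_def field_simps)
  let ?Z = "\<lambda>i x. exp (s * (Y i x - m))"
  have "t * ((\<Sum>i\<in>{1..n}. Y i x) / n - m) = s * ((\<Sum>i\<in>{1..n}. Y i x) - n * m)" for x
    using n by (simp add: s_def field_simps)
  also have "s * ((\<Sum>i\<in>{1..n}. Y i x) - n * m) = (\<Sum>i\<in>{1..n}. s * (Y i x - m))" for x
    by (simp add: sum_subtractf flip: sum_distrib_left)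
  finally have eq: "exp (t * ((\<Sum>i\<in>{1..n}. Y i x) / n - m)) = (\<Prod>i\<in>{1..n}. ?Z i x)" for x
    by (simp add: exp_sum)
  have indZ: "indep_vars (\<lambda>_. borel) ?Z {1..n}"
    by (rule indep_vars_compose2[OF indep, of "\<lambda>_ y. exp (s * (y - m))"]) simp
  have Y: "Y i \<in> borel_measurable M" if "i \<in> {1..n}" for i
    using indep that by (auto simp: indep_vars_def)
  have Z: "integrable M (?Z i)" "expectation (?Z i) \<le> exp (s\<^sup>2 * k\<^sup>2)" if "i \<in> {1..n}" for i
    using exp_moment_centered_le[OF Y[OF that] k int[OF that] le[OF that] s] mean[OF that] by auto
  show "integrable M (\<lambda>x. exp (t * ((\<Sum>i\<in>{1..n}. Y i x) / n - m)))"
    unfolding eq by (intro indep_vars_integrable indZ Z) auto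
  have "expectation (\<lambda>x. \<Prod>i\<in>{1..n}. ?Z i x) = (\<Prod>i\<in>{1..n}. expectation (?Z i))"
    by (intro indep_vars_lebesgue_integral indZ Z) auto
  also have "\<dots> \<le> (\<Prod>i\<in>{1..n}. exp (s\<^sup>2 * k\<^sup>2))"
    by (intro prod_mono conjI Z) (auto intro!: integral_nonneg_AE)
  also have "\<dots> = exp (t\<^sup>2 * k\<^sup>2 / n)"
    using n by (simp add: s_def power2_eq_square flip: exp_of_nat_mult)
  finally show "expectation (\<lambda>x. exp (t * ((\<Sum>i\<in>{1..n}. Y i x) / n - m))) \<le> exp (t\<^sup>2 * k\<^sup>2 / n)"
    unfolding eq .
qed

section \<open>Second-moment matrices under square-exponential integrability\<close>

lemma outer_nth [simp]: "outer x $ i $ j = x $ i * x $ j"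
  by (simp add: outer_def)

lemma borel_measurable_vec_nth [measurable]:
  "(\<lambda>x::'a::euclidean_space^'n. x $ i) \<in> borel_measurable borel"
  by (intro borel_measurable_continuous_onI continuous_intros)

lemma borel_measurable_outer [measurable]: "outer \<in> borel_measurable borel"
  unfolding outer_def by (intro borel_measurable_continuous_onI continuous_intros)

text \<open>Every one-dimensional marginal has Orlicz norm at most \<open>K\<close>, with the moment
  bound holding at \<open>K\<close> itself. The nonnegative integral allows integrability to be
  derived from the bound.\<close>

locale square_exp_integrable = prob_space \<mu>
  for \<mu> :: "(real^'n) measure" and K :: real +
  assumes sets_eq [measurable_cong]: "sets \<mu> = sets borel"
    and K_pos: "K > 0"
    and nn_exp_le: "\<And>v. norm v = 1 \<Longrightarrow> (\<integral>\<^sup>+x. ennreal (exp ((x \<bullet> v)\<^sup>2 / K\<^sup>2)) \<partial>\<mu>) \<le> 2"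
begin

lemma exp_integrable:
  assumes "norm v = 1"
  shows "integrable \<mu> (\<lambda>x. exp ((x \<bullet> v)\<^sup>2 / K\<^sup>2))"
  using nn_exp_le[OF assms] by (intro integrableI_nonneg) (auto simp: order_le_less_trans)

lemma exp_expectation_le:
  assumes "norm v = 1"
  shows "expectation (\<lambda>x. exp ((x \<bullet> v)\<^sup>2 / K\<^sup>2)) \<le> 2"
  using nn_exp_le[OF assms] nn_integral_eq_integral[OF exp_integrable[OF assms]]
  by (simp flip: ennreal_numeral)

text \<open>The arithmetic-geometric inequality is used twice, first in the exponent and then for
  the product of exponentials. A product of two coordinates is thus subexponential at scale
  \<open>K\<^sup>2\<close>.\<close>

lemma exp_nth_mult_le: "exp (\<bar>x $ i * x $ j\<bar> / K\<^sup>2) \<le>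
    (exp ((x \<bullet> axis i 1)\<^sup>2 / K\<^sup>2) + exp ((x \<bullet> axis j 1)\<^sup>2 / K\<^sup>2)) / 2"
proof -
  let ?a = "\<bar>x $ i\<bar> / K" and ?b = "\<bar>x $ j\<bar> / K"
  have "exp (\<bar>x $ i * x $ j\<bar> / K\<^sup>2) \<le> exp (?a\<^sup>2 / 2) * exp (?b\<^sup>2 / 2)"
    using sum_squares_bound[of ?a ?b]
    by (simp add: abs_mult power2_eq_square flip: exp_add)
  also have "\<dots> \<le> ((exp (?a\<^sup>2 / 2))\<^sup>2 + (exp (?b\<^sup>2 / 2))\<^sup>2) / 2"
    using sum_squares_bound[of "exp (?a\<^sup>2 / 2)" "exp (?b\<^sup>2 / 2)"] by simp
  also have "\<dots> = (exp ((x \<bullet> axis i 1)\<^sup>2 / K\<^sup>2) + exp ((x \<bullet> axis j 1)\<^sup>2 / K\<^sup>2)) / 2"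
    by (simp add: inner_axis power_divide flip: exp_double)
  finally show ?thesis .
qed

lemma exp_nth_mult_integrable: "integrable \<mu> (\<lambda>x. exp (\<bar>x $ i * x $ j\<bar> / K\<^sup>2))"
proof (rule Bochner_Integration.integrable_bound)
  show "integrable \<mu> (\<lambda>x. (exp ((x \<bullet> axis i 1)\<^sup>2 / K\<^sup>2) + exp ((x \<bullet> axis j 1)\<^sup>2 / K\<^sup>2)) / 2)"
    using exp_integrable[of "axis i 1"] exp_integrable[of "axis j 1"] by simp
  show "AE x in \<mu>. norm (exp (\<bar>x $ i * x $ j\<bar> / K\<^sup>2)) \<le>
      norm ((exp ((x \<bullet> axis i 1)\<^sup>2 / K\<^sup>2) + exp ((x \<bullet> axis j 1)\<^sup>2 / K\<^sup>2)) / 2)"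
    using order_trans[OF exp_nth_mult_le abs_ge_self] by (intro AE_I2) simp
qed simp

lemma exp_nth_mult_expectation_le: "expectation (\<lambda>x. exp (\<bar>x $ i * x $ j\<bar> / K\<^sup>2)) \<le> 2"
proof -
  have i: "integrable \<mu> (\<lambda>x. exp ((x \<bullet> axis i 1)\<^sup>2 / K\<^sup>2))" for i by (rule exp_integrable) simp
  have "expectation (\<lambda>x. exp (\<bar>x $ i * x $ j\<bar> / K\<^sup>2)) \<le>
      expectation (\<lambda>x. (exp ((x \<bullet> axis i 1)\<^sup>2 / K\<^sup>2) + exp ((x \<bullet> axis j 1)\<^sup>2 / K\<^sup>2)) / 2)"
    using i by (intro integral_mono exp_nth_mult_integrable exp_nth_mult_le) auto
  also have "\<dots> \<le> 2"
    using i[of i] i[of j] exp_expectation_le[of "axis i 1"] exp_expectation_le[of "axis j 1"] by simp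
  finally show ?thesis .
qed

lemma nth_mult_integrable: "integrable \<mu> (\<lambda>x. x $ i * x $ j)"
proof -
  have "norm (x $ i * x $ j) \<le> norm (K\<^sup>2 * exp (\<bar>x $ i * x $ j\<bar> / K\<^sup>2))" for x :: "real^'n"
  proof -
    have "\<bar>x $ i * x $ j\<bar> / K\<^sup>2 \<le> exp (\<bar>x $ i * x $ j\<bar> / K\<^sup>2)"
      using exp_ge_add_one_self[of "\<bar>x $ i * x $ j\<bar> / K\<^sup>2"] by linarith
    thus ?thesis using K_pos by (simp add: field_simps)
  qed
  thus ?thesis
    by (intro Bochner_Integration.integrable_bound[OF integrable_mult_right[OF exp_nth_mult_integrable, of "K\<^sup>2"]])
       auto
qed

lemma outer_integrable: "integrable \<mu> outer"
proof (rule Bochner_Integration.integrable_bound)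
  show "integrable \<mu> (\<lambda>x. \<Sum>i\<in>UNIV. \<Sum>j\<in>UNIV. \<bar>x $ i * x $ j\<bar>)"
    by (intro Bochner_Integration.integrable_sum integrable_abs nth_mult_integrable)
  have "norm (outer x) \<le> (\<Sum>i\<in>UNIV. \<Sum>j\<in>UNIV. \<bar>x $ i * x $ j\<bar>)" for x :: "real^'n"
  proof -
    have "norm (outer x) \<le> (\<Sum>i\<in>UNIV. norm (outer x $ i))" by (simp add: norm_vec_def[of "outer x"] L2_set_le_sum)
    also have "\<dots> \<le> (\<Sum>i\<in>UNIV. \<Sum>j\<in>UNIV. \<bar>outer x $ i $ j\<bar>)" by (intro sum_mono norm_le_l1_cart)
    finally show ?thesis by simp
  qed
  thus "AE x in \<mu>. norm (outer x) \<le> norm (\<Sum>i\<in>UNIV. \<Sum>j\<in>UNIV. \<bar>x $ i * x $ j\<bar>)"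
    by (auto intro!: AE_I2 order_trans[OF _ abs_ge_self])
qed simp

text \<open>Linear functionals pass under the matrix-valued integral; entries and quadratic forms
  are the instances of interest.\<close>

lemma cov_matrix_linear:
  assumes "linear f"
  shows "f (cov_matrix \<mu>) = expectation (\<lambda>x. f (outer x) :: real)"
  unfolding cov_matrix_def
  using integral_bounded_linear[OF linear_conv_bounded_linear[THEN iffD1, OF assms] outer_integrable]
  by simp

lemma cov_matrix_nth: "cov_matrix \<mu> $ i $ j = expectation (\<lambda>x. x $ i * x $ j)"
  using cov_matrix_linear[of "\<lambda>A. A $ i $ j"] by (simp add: linear_iff)

lemma transpose_cov_matrix: "transpose (cov_matrix \<mu>) = cov_matrix \<mu>"
  by (simp add: vec_eq_iff transpose_def cov_matrix_nth mult.commute)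

lemma cov_matrix_quadratic: "(cov_matrix \<mu> *v v) \<bullet> v = expectation (\<lambda>x. (x \<bullet> v)\<^sup>2)"
proof -
  have "(outer x *v v) \<bullet> v = (x \<bullet> v)\<^sup>2" for x
    by (simp add: inner_vec_def matrix_vector_mult_def power2_eq_square
        sum_distrib_left sum_distrib_right mult_ac)
  moreover have "linear (\<lambda>A. (A *v v) \<bullet> v)"
    by (simp add: linear_iff matrix_vector_mult_add_rdistrib inner_add_left scaleR_matrix_vector_assoc[symmetric])
  ultimately show ?thesis using cov_matrix_linear[of "\<lambda>A. (A *v v) \<bullet> v"] by simp
qed

text \<open>From \<open>y \<le> exp y - 1\<close> and the exponential moment bound 2. This later
  excludes \<open>K = 0\<close>.\<close>

lemma cov_matrix_quadratic_le:
  assumes "norm v = 1"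
  shows "(cov_matrix \<mu> *v v) \<bullet> v \<le> K\<^sup>2"
proof -
  have le: "(x \<bullet> v)\<^sup>2 \<le> K\<^sup>2 * (exp ((x \<bullet> v)\<^sup>2 / K\<^sup>2) - 1)" for x
    using exp_ge_add_one_self[of "(x \<bullet> v)\<^sup>2 / K\<^sup>2"] K_pos by (simp add: field_simps)
  note i = exp_integrable[OF assms]
  have "integrable \<mu> (\<lambda>x. (x \<bullet> v)\<^sup>2)"
    by (rule Bochner_Integration.integrable_bound[of _ "\<lambda>x. K\<^sup>2 * (exp ((x \<bullet> v)\<^sup>2 / K\<^sup>2) - 1)"])
       (use i le in \<open>auto intro!: AE_I2 order_trans[OF le abs_ge_self]\<close>)
  hence "expectation (\<lambda>x. (x \<bullet> v)\<^sup>2) \<le> expectation (\<lambda>x. K\<^sup>2 * (exp ((x \<bullet> v)\<^sup>2 / K\<^sup>2) - 1))"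
    using i by (intro integral_mono le) auto
  also have "\<dots> = K\<^sup>2 * (expectation (\<lambda>x. exp ((x \<bullet> v)\<^sup>2 / K\<^sup>2)) - 1)"
    using i by (simp add: prob_space)
  also have "\<dots> \<le> K\<^sup>2 * 1" using exp_expectation_le[OF assms] by (intro mult_left_mono) auto
  finally show ?thesis by (simp add: cov_matrix_quadratic)
qed

end

subsection \<open>Concentration of the empirical covariance\<close>

text \<open>The partial sum of a series of nonnegative terms; it turns a \<open>cosh\<close> moment
  into a second moment.\<close>

lemma cosh_lower_Taylor_quadratic: "1 + x\<^sup>2 / 2 \<le> cosh (x :: real)"
proof -
  let ?t = "\<lambda>n. if even n then x ^ n /\<^sub>R fact n else 0"
  have "sum ?t {..<3} \<le> suminf ?t"
    using cosh_converges[of x] by (intro sum_le_suminf) (auto simp: sums_iff)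
  also have "suminf ?t = cosh x" using cosh_converges[of x] by (simp add: sums_iff)
  finally show ?thesis by (simp add: eval_nat_numeral)
qed

lemma transpose_empirical_cov: "transpose (empirical_cov n X \<omega>) = empirical_cov n X \<omega>"
  by (simp add: vec_eq_iff transpose_def empirical_cov_def mult.commute)

locale iid_sample = M: prob_space M + square_exp_integrable \<mu> K
  for M :: "'w measure" and \<mu> :: "(real^'n) measure" and K :: real +
  fixes X :: "nat \<Rightarrow> 'w \<Rightarrow> real^'n" and n :: nat
  assumes n: "n \<ge> 1"
    and indep: "M.indep_vars (\<lambda>_. borel) X {1..n}"
    and law: "\<And>i. i \<in> {1..n} \<Longrightarrow> distr M borel (X i) = \<mu>"
begin

text \<open>The root mean square of the entries of the error matrix. With this normalisation the
  same parameter \<open>t\<close> serves the norm and the entries.\<close>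

definition dev :: "'w \<Rightarrow> real" where
  "dev \<omega> = norm (empirical_cov n X \<omega> - cov_matrix \<mu>) / CARD('n)"

lemma X_measurable: "i \<in> {1..n} \<Longrightarrow> X i \<in> borel_measurable M"
  using indep by (auto simp: M.indep_vars_def)

lemma empirical_cov_measurable [measurable]: "empirical_cov n X \<in> borel_measurable M"
proof -
  have "(\<lambda>\<omega>. outer (X i \<omega>)) \<in> borel_measurable M" if "i \<in> {1..n}" for i
    using X_measurable[OF that] by measurable
  thus ?thesis unfolding empirical_cov_def[abs_def]
    by (intro borel_measurable_scaleR borel_measurable_const borel_measurable_sum)
qed

lemma dev_measurable [measurable]: "dev \<in> borel_measurable M"
  unfolding dev_def[abs_def] by measurable

text \<open>An entry of the error is a centred average of coordinate products, which are
  subexponential at scale \<open>k = K\<^sup>2\<close>.\<close>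

lemma exp_moment_entry:
  assumes t: "\<bar>t\<bar> \<le> n / K\<^sup>2"
  shows "integrable M (\<lambda>\<omega>. exp (t * (empirical_cov n X \<omega> - cov_matrix \<mu>) $ i $ j))" (is ?int)
    and "M.expectation (\<lambda>\<omega>. exp (t * (empirical_cov n X \<omega> - cov_matrix \<mu>) $ i $ j)) \<le>
           exp (t\<^sup>2 * K ^ 4 / n)" (is ?le)
proof -
  let ?Y = "\<lambda>k \<omega>. X k \<omega> $ i * X k \<omega> $ j"
  have indY: "M.indep_vars (\<lambda>_. borel) ?Y {1..n}"
    by (rule M.indep_vars_compose2[OF indep, of "\<lambda>_ x. x $ i * x $ j"]) simp
  have int: "integrable M (\<lambda>\<omega>. exp (\<bar>?Y k \<omega>\<bar> / K\<^sup>2))"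
    and le: "M.expectation (\<lambda>\<omega>. exp (\<bar>?Y k \<omega>\<bar> / K\<^sup>2)) \<le> 2"
    if k: "k \<in> {1..n}" for k
    using exp_nth_mult_integrable[of i j] exp_nth_mult_expectation_le[of i j] X_measurable[OF k]
    unfolding law[OF k, symmetric] by (simp_all add: integrable_distr_eq integral_distr)
  have mean: "M.expectation (?Y k) = cov_matrix \<mu> $ i $ j" if k: "k \<in> {1..n}" for k
    using integral_distr[OF X_measurable[OF k], of "\<lambda>x. x $ i * x $ j"]
    by (simp add: law[OF k] cov_matrix_nth)
  have eq: "(empirical_cov n X \<omega> - cov_matrix \<mu>) $ i $ j = (\<Sum>k\<in>{1..n}. ?Y k \<omega>) / n - cov_matrix \<mu> $ i $ j" for \<omega>
    by (simp add: empirical_cov_def sum_component)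
  show ?int ?le
    unfolding eq using M.exp_moment_average_le[OF indY n _ int le mean t] K_pos by simp_all
qed

text \<open>The entrywise bounds at \<open>t\<close> and \<open>- t\<close> give the same bound for
  \<open>cosh\<close> of every entry, and averaging over entries preserves it.\<close>

lemma cosh_moment:
  assumes t: "\<bar>t\<bar> \<le> n / K\<^sup>2"
  shows "integrable M (\<lambda>\<omega>. cosh (t * dev \<omega>))"
    and "M.expectation (\<lambda>\<omega>. cosh (t * dev \<omega>)) \<le> exp (t\<^sup>2 * K ^ 4 / n)"
proof -
  let ?D = "\<lambda>\<omega>. empirical_cov n X \<omega> - cov_matrix \<mu>"
  let ?c = "\<lambda>i j \<omega>. cosh (t * ?D \<omega> $ i $ j)"
  let ?R = "\<lambda>\<omega>. (\<Sum>(i, j)\<in>UNIV. ?c i j \<omega>) / (real CARD('n))\<^sup>2"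
  have t': "\<bar>- t\<bar> \<le> n / K\<^sup>2" using t by simp
  have int: "integrable M (?c i j)" for i j
    using exp_moment_entry(1)[OF t, of i j] exp_moment_entry(1)[OF t', of i j]
    unfolding cosh_def by simp
  have le: "M.expectation (?c i j) \<le> exp (t\<^sup>2 * K ^ 4 / n)" for i j
    using exp_moment_entry[OF t, of i j] exp_moment_entry[OF t', of i j]
    unfolding cosh_def by simp
  have bound: "cosh (t * dev \<omega>) \<le> ?R \<omega>" for \<omega>
    unfolding dev_def by (rule cosh_norm_matrix_le)
  have intR: "integrable M ?R"
    unfolding case_prod_unfold
    by (intro integrable_divide Bochner_Integration.integrable_sum int)
  show int': "integrable M (\<lambda>\<omega>. cosh (t * dev \<omega>))"
  proof (rule Bochner_Integration.integrable_bound[OF intR])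
    show "(\<lambda>\<omega>. cosh (t * dev \<omega>)) \<in> borel_measurable M"
      unfolding cosh_def by measurable
    show "AE \<omega> in M. norm (cosh (t * dev \<omega>)) \<le> norm (?R \<omega>)"
      using order_trans[OF bound abs_ge_self] by (intro AE_I2) simp
  qed
  have "M.expectation (\<lambda>\<omega>. cosh (t * dev \<omega>)) \<le> M.expectation ?R"
    by (intro integral_mono int' intR bound)
  also have "\<dots> = (\<Sum>(i, j)\<in>UNIV. M.expectation (?c i j)) / (real CARD('n))\<^sup>2"
    using int by (simp add: case_prod_unfold)
  also have "\<dots> \<le> (\<Sum>(i, j)\<in>(UNIV :: ('n \<times> 'n) set). exp (t\<^sup>2 * K ^ 4 / n)) / (real CARD('n))\<^sup>2"
    using le by (intro divide_right_mono sum_mono) auto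
  also have "\<dots> = exp (t\<^sup>2 * K ^ 4 / n)"
    by (simp add: power2_eq_square)
  finally show "M.expectation (\<lambda>\<omega>. cosh (t * dev \<omega>)) \<le> exp (t\<^sup>2 * K ^ 4 / n)" .
qed

text \<open>Markov's inequality with parameter \<open>n * a / K\<^sup>2\<close>, which turns the
  admissible range into \<open>a \<le> 1\<close>. The factor 2 comes from
  \<open>exp y \<le> 2 * cosh y\<close>.\<close>

lemma dev_tail_chernoff:
  fixes a b :: real
  assumes a: "0 \<le> a" "a \<le> 1"
  shows "M.prob {\<omega> \<in> space M. dev \<omega> \<ge> K\<^sup>2 * b} \<le> 2 * exp (n * a\<^sup>2 - n * a * b)"
proof -
  define t where "t = n * a / K\<^sup>2"
  have "n * a \<le> n" using a n by (simp add: mult_left_le)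
  hence t: "\<bar>t\<bar> \<le> n / K\<^sup>2" "t \<ge> 0"
    using a by (auto simp: t_def divide_right_mono)
  have exps: "t\<^sup>2 * K ^ 4 / n = n * a\<^sup>2" "t * (K\<^sup>2 * b) = n * a * b"
    using n K_pos by (simp_all add: t_def field_simps power2_eq_square power4_eq_xxxx)
  have sub: "{\<omega> \<in> space M. dev \<omega> \<ge> K\<^sup>2 * b} \<subseteq> {\<omega> \<in> space M. cosh (t * dev \<omega>) \<ge> exp (n * a * b) / 2}"
  proof safe
    fix \<omega> assume "K\<^sup>2 * b \<le> dev \<omega>"
    hence "t * (K\<^sup>2 * b) \<le> t * dev \<omega>" using t by (intro mult_left_mono)
    hence "exp (n * a * b) / 2 \<le> exp (t * dev \<omega>) / 2" unfolding exps by simp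
    also have "\<dots> \<le> cosh (t * dev \<omega>)" by (simp add: cosh_def)
    finally show "exp (n * a * b) / 2 \<le> cosh (t * dev \<omega>)" .
  qed
  have "M.prob {\<omega> \<in> space M. dev \<omega> \<ge> K\<^sup>2 * b} \<le> M.prob {\<omega> \<in> space M. cosh (t * dev \<omega>) \<ge> exp (n * a * b) / 2}"
    by (intro M.finite_measure_mono sub) (simp add: cosh_def)
  also have "\<dots> \<le> M.expectation (\<lambda>\<omega>. cosh (t * dev \<omega>)) / (exp (n * a * b) / 2)"
    by (intro integral_Markov_inequality_measure[where A="{}"] cosh_moment t) auto
  also have "\<dots> \<le> exp (n * a\<^sup>2) / (exp (n * a * b) / 2)"
    using cosh_moment(2)[OF t(1)] unfolding exps by (intro divide_right_mono) auto
  also have "\<dots> = 2 * exp (n * a\<^sup>2 - n * a * b)" by (simp add: exp_diff)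
  finally show ?thesis .
qed

lemma dev_tail:
  assumes t: "t \<ge> 0"
  shows "M.prob {\<omega> \<in> space M. dev \<omega> \<ge> 2 * K\<^sup>2 * (1 / sqrt n + sqrt (t / n) + t / n)} \<le> exp (- t)"
proof -
  \<comment> \<open>The surplus 1 pays for the Chernoff prefactor, since
    \<open>2 \<le> exp 1\<close>.\<close>
  define r where "r = 1 + t"
  define B where "B = 1 / sqrt n + sqrt (t / n) + t / n"
  define b where "b = 2 * B"
  \<comment> \<open>the minimiser of the Chernoff exponent, truncated to the admissible range\<close>
  define a where "a = min 1 (sqrt (r / n))"
  have N: "real n \<ge> 1" "real n > 0" using n by auto
  have a: "0 \<le> a" "a \<le> 1" using t by (auto simp: a_def r_def)
  have "n * a * (b - a) \<ge> r"
  \<comment> \<open>The first case is the Gaussian regime, where \<open>a \<le> B\<close> suffices;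
    in the second the exponent is linear and \<open>r > n\<close> absorbs the term
    \<open>n * a\<^sup>2\<close>.\<close>
  proof (cases "r \<le> n")
    case True
    hence ar: "a = sqrt (r / n)" using N t by (simp add: a_def r_def)
    have "sqrt (r / n) \<le> 1 / sqrt n + sqrt (t / n)"
      using sqrt_add_le_add_sqrt[of "1 / n" "t / n"] t
      by (simp add: r_def add_divide_distrib real_sqrt_divide)
    moreover have "0 \<le> t / n" using t by simp
    ultimately have "a \<le> B" unfolding B_def ar by (rule add_increasing2[rotated])
    hence "a \<le> b - a" by (simp add: b_def)
    hence "n * a * a \<le> n * a * (b - a)" using a by (intro mult_left_mono) auto
    moreover have "n * a * a = r" using t N by (simp add: ar r_def mult.assoc)
    ultimately show ?thesis by simp
  next
    case False
    hence ar: "a = 1" using N by (simp add: a_def)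
    have "sqrt n * 1 \<le> sqrt n * sqrt n" using N by (intro mult_left_mono) auto
    \<comment> \<open>The term \<open>1 / sqrt n\<close> of \<open>B\<close> covers the surplus in
      \<open>r / n\<close>.\<close>
    hence "1 / n \<le> 1 / sqrt n" using N by (simp add: field_simps)
    hence "1 / n + t / n \<le> B" unfolding B_def
      by (intro add_right_mono add_increasing2) (use t in auto)
    hence "b \<ge> 2 * (r / n)" by (simp add: b_def r_def add_divide_distrib)
    hence "n * b \<ge> 2 * r" using N by (simp add: field_simps)
    thus ?thesis using False by (simp add: ar algebra_simps)
  qed
  hence "n * a\<^sup>2 - n * a * b \<le> - r" by (simp add: algebra_simps power2_eq_square)
  hence "2 * exp (n * a\<^sup>2 - n * a * b) \<le> 2 * exp (- r)" by simp
  also have "\<dots> \<le> exp 1 * exp (- r)"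
    using exp_ge_add_one_self[of 1] by (intro mult_right_mono) auto
  also have "\<dots> = exp (- t)" by (simp add: r_def flip: exp_add)
  finally have "M.prob {\<omega> \<in> space M. dev \<omega> \<ge> K\<^sup>2 * b} \<le> exp (- t)"
    using dev_tail_chernoff[OF a, of b] by simp
  moreover have "K\<^sup>2 * b = 2 * K\<^sup>2 * B" by (simp add: b_def)
  ultimately show ?thesis by (simp only: B_def)
qed

lemma dev_second_moment:
  shows "integrable M (\<lambda>\<omega>. (dev \<omega>)\<^sup>2)"
    and "M.expectation (\<lambda>\<omega>. (dev \<omega>)\<^sup>2) \<le> 4 * K ^ 4 / n"
proof -
  \<comment> \<open>At this scale the \<open>cosh\<close> moment is at most \<open>exp 1\<close>,
    uniformly in \<open>n\<close>.\<close>
  define t where "t = sqrt n / K\<^sup>2"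
  have N: "real n \<ge> 1" using n by simp
  have tp: "t > 0" using n K_pos by (simp add: t_def)
  have "sqrt n * 1 \<le> sqrt n * sqrt n" using N by (intro mult_left_mono) auto
  hence t: "\<bar>t\<bar> \<le> n / K\<^sup>2" by (simp add: t_def divide_right_mono)
  have t2: "t\<^sup>2 = n / K ^ 4" using K_pos by (simp add: t_def power_divide flip: power_mult)
  have exps: "t\<^sup>2 * K ^ 4 / n = 1" using n K_pos by (simp add: t2)
  have bound: "(dev \<omega>)\<^sup>2 \<le> 2 / t\<^sup>2 * (cosh (t * dev \<omega>) - 1)" for \<omega>
    using cosh_lower_Taylor_quadratic[of "t * dev \<omega>"] tp by (simp add: field_simps)
  note c = cosh_moment[OF t, unfolded exps]
  have i: "integrable M (\<lambda>\<omega>. 2 / t\<^sup>2 * (cosh (t * dev \<omega>) - 1))" using c(1) by simp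
  show int: "integrable M (\<lambda>\<omega>. (dev \<omega>)\<^sup>2)"
  proof (rule Bochner_Integration.integrable_bound[OF i])
    show "AE \<omega> in M. norm ((dev \<omega>)\<^sup>2) \<le> norm (2 / t\<^sup>2 * (cosh (t * dev \<omega>) - 1))"
      using order_trans[OF bound abs_ge_self] by (intro AE_I2) simp
  qed measurable
  have "M.expectation (\<lambda>\<omega>. (dev \<omega>)\<^sup>2) \<le> M.expectation (\<lambda>\<omega>. 2 / t\<^sup>2 * (cosh (t * dev \<omega>) - 1))"
    by (intro integral_mono int i bound)
  also have "\<dots> = 2 / t\<^sup>2 * (M.expectation (\<lambda>\<omega>. cosh (t * dev \<omega>)) - 1)"
    using c(1) by (simp add: M.prob_space)
  \<comment> \<open>Here \<open>exp 1 \<le> 3\<close> bounds the bracket by 2.\<close>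
  also have "\<dots> \<le> 2 / t\<^sup>2 * 2"
    using c(2) exp_le by (intro mult_left_mono) auto
  finally show "M.expectation (\<lambda>\<omega>. (dev \<omega>)\<^sup>2) \<le> 4 * K ^ 4 / n" by (simp add: t2)
qed

end

subsection \<open>From the Orlicz norm to exponential moments\<close>

text \<open>Some admissible constant lies below \<open>c\<close>, and enlarging the constant
  decreases the integrand.\<close>

lemma nn_integral_exp_le_psi2_norm:
  fixes Z :: "'a \<Rightarrow> real"
  assumes "psi2_norm M Z < ennreal c" "0 < c"
  shows "(\<integral>\<^sup>+x. ennreal (exp ((Z x)\<^sup>2 / c\<^sup>2)) \<partial>M) \<le> 2"
proof -
  from assms obtain c' where c': "0 < c'" "(\<integral>\<^sup>+ x. ennreal (exp (\<bar>Z x\<bar>\<^sup>2 / c'\<^sup>2)) \<partial>M) \<le> 2" "ennreal c' < ennreal c"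
    unfolding psi2_norm_def INF_less_iff by auto
  hence "c' < c" using ennreal_less_iff[of c' c] by simp
  hence "c'\<^sup>2 \<le> c\<^sup>2" using c' by (intro power_mono) auto
  hence "(\<integral>\<^sup>+x. ennreal (exp ((Z x)\<^sup>2 / c\<^sup>2)) \<partial>M) \<le> (\<integral>\<^sup>+ x. ennreal (exp (\<bar>Z x\<bar>\<^sup>2 / c'\<^sup>2)) \<partial>M)"
    using c' assms(2) by (intro nn_integral_mono ennreal_leI) (auto intro!: divide_left_mono)
  also note c'(2)
  finally show ?thesis .
qed

text \<open>Fatou's lemma along constants decreasing to \<open>K\<close>: the infimum in the Orlicz
  norm is attained when it is positive.\<close>

lemma nn_integral_exp_le_limit:
  fixes Z :: "'a \<Rightarrow> real"
  assumes Z: "Z \<in> borel_measurable M" and K: "K > 0"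
    and le: "\<And>c. c > K \<Longrightarrow> (\<integral>\<^sup>+x. ennreal (exp ((Z x)\<^sup>2 / c\<^sup>2)) \<partial>M) \<le> 2"
  shows "(\<integral>\<^sup>+x. ennreal (exp ((Z x)\<^sup>2 / K\<^sup>2)) \<partial>M) \<le> 2"
proof -
  note [measurable] = Z
  define c where "c k = K + 1 / real (Suc k)" for k
  have "c \<longlonglongrightarrow> K + 0" unfolding c_def
    by (intro tendsto_add tendsto_const LIMSEQ_Suc lim_1_over_n)
  hence lim: "(\<lambda>k. ennreal (exp ((Z x)\<^sup>2 / (c k)\<^sup>2))) \<longlonglongrightarrow> ennreal (exp ((Z x)\<^sup>2 / K\<^sup>2))" for x
    using K by (intro tendsto_ennrealI tendsto_exp tendsto_divide tendsto_const tendsto_power) auto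
  have "(\<integral>\<^sup>+x. ennreal (exp ((Z x)\<^sup>2 / K\<^sup>2)) \<partial>M) =
      (\<integral>\<^sup>+x. liminf (\<lambda>k. ennreal (exp ((Z x)\<^sup>2 / (c k)\<^sup>2))) \<partial>M)"
    using lim_imp_Liminf[OF _ lim] by simp
  also have "\<dots> \<le> liminf (\<lambda>k. \<integral>\<^sup>+x. ennreal (exp ((Z x)\<^sup>2 / (c k)\<^sup>2)) \<partial>M)"
    by (intro nn_integral_liminf) measurable
  also have "\<dots> \<le> liminf (\<lambda>k::nat. 2 :: ennreal)"
    using le by (intro Liminf_mono always_eventually) (auto simp: c_def)
  also have "\<dots> = 2" by (simp add: Liminf_const)
  finally show ?thesis .
qed

text \<open>The delicate point is \<open>K > 0\<close>, which the spectral gap supplies: it forces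
  \<open>lam 1 > 0\<close>, whereas \<open>K = 0\<close> would make the quadratic form of the
  covariance arbitrarily small on the sphere.\<close>

lemma square_exp_integrable_psi2_norm_vec:
  fixes \<mu> :: "(real^'n) measure"
  assumes mu: "prob_space \<mu>" "sets \<mu> = sets borel"
    and fin: "psi2_norm_vec \<mu> (\<lambda>x. x) < \<infinity>" and K: "K = enn2real (psi2_norm_vec \<mu> (\<lambda>x. x))"
    and eig: "eigenvalues_desc (cov_matrix \<mu>) lam" and card: "CARD('n) \<ge> 2" and gap: "lam 1 > lam 2"
  shows "square_exp_integrable \<mu> K"
proof -
  interpret prob_space \<mu> by fact
  have [measurable_cong]: "sets \<mu> = sets borel" by fact
  have K0: "K \<ge> 0" by (simp add: K)
  have le: "(\<integral>\<^sup>+x. ennreal (exp ((x \<bullet> v)\<^sup>2 / c\<^sup>2)) \<partial>\<mu>) \<le> 2" if "c > K" "norm v = 1" for c v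
  proof (rule nn_integral_exp_le_psi2_norm)
    have "psi2_norm \<mu> (\<lambda>x. x \<bullet> v) \<le> psi2_norm_vec \<mu> (\<lambda>x. x)"
      unfolding psi2_norm_vec_def using that by (intro SUP_upper) auto
    also have "\<dots> = ennreal K" using fin by (simp add: K)
    also have "\<dots> < ennreal c" using that K0 by (simp add: ennreal_less_iff)
    finally show "psi2_norm \<mu> (\<lambda>x. x \<bullet> v) < ennreal c" .
    show "0 < c" using that K0 by simp
  qed
  have sq: "square_exp_integrable \<mu> c" if "c > K" for c
    using that K0 le by unfold_locales (auto simp: mu)
  have lam1: "lam 1 > 0"
  proof -
    \<comment> \<open>Any constant above \<open>K\<close> would do; it makes the covariance form
      available as a mean of squares.\<close>
    interpret s: square_exp_integrable \<mu> "K + 1" by (rule sq) simp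
    obtain v where v: "v \<noteq> 0" "cov_matrix \<mu> *v v = lam 2 *\<^sub>R v"
      using eigenvalue_iff_listed[OF eig, of "lam 2"] card by force
    have "lam 2 * (v \<bullet> v) = (cov_matrix \<mu> *v v) \<bullet> v" by (simp add: v)
    also have "\<dots> \<ge> 0" unfolding s.cov_matrix_quadratic by simp
    finally have "0 \<le> lam 2 * (v \<bullet> v)" .
    moreover have "v \<bullet> v > 0" using v by simp
    ultimately have "lam 2 \<ge> 0" by (simp add: zero_le_mult_iff)
    thus ?thesis using gap by simp
  qed
  have "K \<noteq> 0"
  proof
    assume "K = 0"
    \<comment> \<open>Chosen so that the bound \<open>lam 1 \<le> c\<^sup>2\<close> is
      absurd.\<close>
    define c where "c = sqrt (lam 1 / 2)"
    have "c > K" using lam1 \<open>K = 0\<close> by (simp add: c_def)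
    then interpret s: square_exp_integrable \<mu> c by (rule sq)
    obtain u where "norm u = 1" "(cov_matrix \<mu> *v u) \<bullet> u = lam 1"
      using spectral_gap[OF s.transpose_cov_matrix card eig gap] by blast
    hence "lam 1 \<le> c\<^sup>2" using s.cov_matrix_quadratic_le by metis
    thus False using lam1 by (simp add: c_def)
  qed
  hence "K > 0" using K0 by simp
  thus ?thesis
    using nn_integral_exp_le_limit[of _ \<mu> K] le by unfold_locales (auto simp: mu)
qed

section \<open>Tail and second-moment bounds for the angular deviation\<close>

theorem corollary21:
  fixes \<mu> :: "(real^'d) measure"
    and M :: "'w measure"
    and X :: "nat \<Rightarrow> 'w \<Rightarrow> real^'d"
    and n :: nat
    and lam :: "nat \<Rightarrow> real"
    and d K c L C1 C2 :: real
    and S :: "(real^'d) set"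
    and S_hat :: "'w \<Rightarrow> (real^'d) set"
  assumes dim: "CARD('d) \<ge> 2" "d = real CARD('d)"
    and mu: "prob_space \<mu>" "sets \<mu> = sets borel"
    and centered: "(\<integral>x. x \<partial>\<mu>) = 0"
    and subgaussian: "psi2_norm_vec \<mu> (\<lambda>x. x) < \<infinity>"
    and K: "K = enn2real (psi2_norm_vec \<mu> (\<lambda>x. x))"
    and eigenvalues: "eigenvalues_desc (cov_matrix \<mu>) lam"
    and gap: "lam 1 > lam 2"
    and n: "n \<ge> 1"
    and M: "prob_space M"
    and indep: "prob_space.indep_vars M (\<lambda>_. borel) X {1..n}"
    and law: "\<And>i. i \<in> {1..n} \<Longrightarrow> distr M borel (X i) = \<mu>"
    and S: "S = max_directions (cov_matrix \<mu>)"
    and S_hat: "\<And>\<omega>. S_hat \<omega> = max_directions (empirical_cov n X \<omega>)"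
    and c: "c = (lam 1 - lam 2)\<^sup>2 /
                (32 * (exp 1)\<^sup>2 * (d + 1)\<^sup>2 * K ^ 4 + 8 * exp 1 * (d + 1) * K\<^sup>2 * (lam 1 - lam 2))"
    and L: "L = 2 * d * pi\<^sup>2 * K\<^sup>2 / (lam 1 - lam 2)"
    and C1: "C1 = 14 * L + 2 * sqrt (L * pi)"
    and C2: "C2 = 4 * (L * pi + 8 * L\<^sup>2) + pi\<^sup>2"
  shows "(\<forall>\<delta>>0.
            {\<omega> \<in> space M. gc_dev (S_hat \<omega>) S
               \<le> 8 * L * (real n powr (- 1 / 2) + 2 * sqrt (1 / real n * ln (1 / \<delta>)) + 1 / real n * ln (1 / \<delta>))
                 + C1 * d powr (1 / 4) * exp (- (c / 4) * real n)} \<in> sets M \<and>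
            measure M {\<omega> \<in> space M. gc_dev (S_hat \<omega>) S
               \<le> 8 * L * (real n powr (- 1 / 2) + 2 * sqrt (1 / real n * ln (1 / \<delta>)) + 1 / real n * ln (1 / \<delta>))
                 + C1 * d powr (1 / 4) * exp (- (c / 4) * real n)}
              \<ge> 1 - 2 * d * exp (- c * real n) - \<delta>)
       \<and> integrable M (\<lambda>\<omega>. (gc_dev (S_hat \<omega>) S)\<^sup>2)
       \<and> prob_space.expectation M (\<lambda>\<omega>. (gc_dev (S_hat \<omega>) S)\<^sup>2)
           \<le> 2 ^ 6 * L\<^sup>2 * (1 / real n) + C2 * d powr (1 / 2) * exp (- (c / 2) * real n)"
proof -
  have sq: "square_exp_integrable \<mu> K"
    by (rule square_exp_integrable_psi2_norm_vec[OF mu subgaussian K eigenvalues dim(1) gap])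
  interpret iid_sample M \<mu> K X n
    by (intro iid_sample.intro M sq iid_sample_axioms.intro n indep law)
  define g where "g = lam 1 - lam 2"
  have g: "g > 0" using gap by (simp add: g_def)
  obtain u where u: "norm u = 1" "(cov_matrix \<mu> *v u) \<bullet> u = lam 1"
    and le: "\<And>x. norm x = 1 \<Longrightarrow> (cov_matrix \<mu> *v x) \<bullet> x \<le> lam 1 - g * (1 - (x \<bullet> u)\<^sup>2)"
    unfolding g_def using spectral_gap[OF transpose_cov_matrix dim(1) eigenvalues gap] by metis
  have S_eq: "S = {u, - u}" unfolding S by (rule max_directions_spectral_gap[OF u g le])
  define G where "G \<omega> = gc_dev (S_hat \<omega>) S" for \<omega>
  have G_meas [measurable]: "G \<in> borel_measurable M"
    unfolding G_def[abs_def] S_hat S_eq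
    by (rule measurable_compose[OF empirical_cov_measurable borel_measurable_gc_dev_max_directions[OF u(1)]])
  have G_nonneg: "0 \<le> G \<omega>" for \<omega>
    unfolding G_def S_hat S_eq by (rule gc_dev_max_directions_nonneg[OF u(1)])
  have d: "d \<ge> 2" using dim by simp
  have G_le: "G \<omega> \<le> 4 * d / g * dev \<omega>" for \<omega>
    using gc_dev_le_norm_perturbation[OF transpose_cov_matrix transpose_empirical_cov u g le, of n X \<omega>]
      dim d by (simp add: G_def S_hat S_eq dev_def)
  \<comment> \<open>The constant that perturbation and concentration deliver together;
    \<open>L\<close> equals \<open>2 * pi\<^sup>2 * q\<close> and hence dominates it.\<close>
  define q where "q = d * K\<^sup>2 / g"
  have q: "q \<ge> 0" using d g by (simp add: q_def)
  have "1\<^sup>2 \<le> pi\<^sup>2" using pi_gt3 by (intro power_mono) auto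
  hence "1 * q \<le> (2 * pi\<^sup>2) * q" using q by (intro mult_right_mono) auto
  also have "\<dots> = L" by (simp add: L q_def g_def)
  finally have L_ge: "q \<le> L" by simp
  have C1_nonneg: "C1 \<ge> 0" using q L_ge by (simp add: C1)
  have C2_nonneg: "C2 \<ge> 0" using q L_ge by (simp add: C2)
  let ?R = "\<lambda>\<delta>. 8 * L * (real n powr (- 1 / 2) + 2 * sqrt (1 / real n * ln (1 / \<delta>)) + 1 / real n * ln (1 / \<delta>))
                 + C1 * d powr (1 / 4) * exp (- (c / 4) * real n)"
  have event: "{\<omega> \<in> space M. G \<omega> \<le> r} \<in> sets M" for r by measurable
  have prob: "M.prob {\<omega> \<in> space M. G \<omega> \<le> ?R \<delta>} \<ge> 1 - 2 * d * exp (- c * real n) - \<delta>" if \<delta>: "\<delta> > 0" for \<delta>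
  \<comment> \<open>For \<open>\<delta> \<ge> 1\<close> the logarithm may be negative, but the
    asserted lower bound on the probability is then at most 0.\<close>
  proof (cases "\<delta> \<ge> 1")
    case True
    have "0 \<le> 2 * d * exp (- c * real n)" using d by simp
    hence "1 - 2 * d * exp (- c * real n) - \<delta> \<le> 0" using True by linarith
    thus ?thesis using measure_nonneg order_trans by blast
  next
    case False
    define t where "t = ln (1 / \<delta>)"
    have t: "t \<ge> 0" "exp (- t) = \<delta>" using False \<delta> by (simp_all add: t_def ln_div)
    define B where "B = 1 / sqrt n + sqrt (t / n) + t / n"
    define E where "E = {\<omega> \<in> space M. dev \<omega> \<ge> 2 * K\<^sup>2 * B}"
    have E: "E \<in> sets M" unfolding E_def by measurable
    have B: "0 \<le> B" using t by (simp add: B_def)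
    have "real n powr (- 1 / 2) = 1 / sqrt n"
      using n by (simp add: powr_minus_divide powr_half_sqrt)
    moreover have "0 \<le> sqrt (t / n)" using t by simp
    ultimately have B_le: "B \<le> real n powr (- 1 / 2) + 2 * sqrt (1 / real n * ln (1 / \<delta>)) + 1 / real n * ln (1 / \<delta>)"
      by (simp add: B_def flip: t_def)
    \<comment> \<open>Off the exceptional event \<open>E\<close>, the perturbation bound gives
      \<open>8 * q * B\<close>, which the stated radius dominates.\<close>
    have "space M - E \<subseteq> {\<omega> \<in> space M. G \<omega> \<le> ?R \<delta>}"
    proof safe
      fix \<omega> assume \<omega>: "\<omega> \<in> space M" "\<omega> \<notin> E"
      have "G \<omega> \<le> 4 * d / g * (2 * K\<^sup>2 * B)"
        using \<omega> d g by (intro order_trans[OF G_le] mult_left_mono) (auto simp: E_def)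
      also have "\<dots> = 8 * (q * B)" by (simp add: q_def)
      also have "\<dots> \<le> 8 * (L * (real n powr (- 1 / 2) + 2 * sqrt (1 / real n * ln (1 / \<delta>)) + 1 / real n * ln (1 / \<delta>)))"
        using L_ge q B B_le by (intro mult_left_mono mult_mono) auto
      also have "\<dots> \<le> ?R \<delta>" using C1_nonneg by simp
      finally show "G \<omega> \<le> ?R \<delta>" .
    qed
    hence "M.prob (space M - E) \<le> M.prob {\<omega> \<in> space M. G \<omega> \<le> ?R \<delta>}"
      by (rule M.finite_measure_mono) (rule event)
    moreover have "M.prob E \<le> \<delta>" using dev_tail[OF t(1)] t(2) by (simp add: E_def B_def)
    moreover have "0 \<le> 2 * d * exp (- c * real n)" using d by simp
    ultimately show ?thesis using M.prob_compl[OF E] by linarith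
  qed
  have sq_le: "(G \<omega>)\<^sup>2 \<le> (4 * d / g)\<^sup>2 * (dev \<omega>)\<^sup>2" for \<omega>
    using power_mono[OF G_le G_nonneg, of \<omega> 2] by (simp add: power_mult_distrib power_divide)
  note i = integrable_mult_right[OF dev_second_moment(1), of "(4 * d / g)\<^sup>2"]
  have int: "integrable M (\<lambda>\<omega>. (G \<omega>)\<^sup>2)"
  proof (rule Bochner_Integration.integrable_bound[OF i])
    show "AE \<omega> in M. norm ((G \<omega>)\<^sup>2) \<le> norm ((4 * d / g)\<^sup>2 * (dev \<omega>)\<^sup>2)"
      using sq_le by (intro AE_I2) (simp add: abs_mult)
  qed measurable
  have "M.expectation (\<lambda>\<omega>. (G \<omega>)\<^sup>2) \<le> (4 * d / g)\<^sup>2 * M.expectation (\<lambda>\<omega>. (dev \<omega>)\<^sup>2)"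
    using integral_mono[OF int i sq_le] by simp
  also have "\<dots> \<le> (4 * d / g)\<^sup>2 * (4 * K ^ 4 / n)"
    by (intro mult_left_mono dev_second_moment) simp
  \<comment> \<open>The factors \<open>4\<^sup>2\<close> and 4 combine to the constant
    \<open>2 ^ 6\<close> of the claim, with \<open>q\<close> in place of \<open>L\<close>.\<close>
  also have "\<dots> = 64 * q\<^sup>2 * (1 / n)"
    by (simp add: q_def power_mult_distrib power_divide flip: power_mult)
  also have "\<dots> \<le> 64 * L\<^sup>2 * (1 / n)"
    using L_ge q by (intro mult_right_mono mult_left_mono power_mono) auto
  also have "\<dots> \<le> 2 ^ 6 * L\<^sup>2 * (1 / real n) + C2 * d powr (1 / 2) * exp (- (c / 2) * real n)"
    using C2_nonneg by simp
  finally show ?thesis using event prob int unfolding G_def by blast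
qed

end
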